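(* Let $A,B$ be positive definite matrices and $-1\le t\le-\tfrac12$. Then \[ A\,\widehat{sp}_t\,B\prec_{\log}\left(A^{1-t}B^{2t}A^{1-t}\right)^{1/2}. \]
   Context: For positive definite matrices $A,B$ and $t\in\mathbb{R}$: $A\sharp B:=A^{1/2}(A^{-1/2}BA^{-1/2})^{1/2}A^{1/2}$ and $A\,\widehat{sp}_t\,B:=(A^{-1}\sharp B)^tA(A^{-1}\sharp B)^t$. For $n\times n$ positive semidefinite matrices $X,Y$ with eigenvalues $\lambda_1(\cdot)\ge\dots\ge\lambda_n(\cdot)$, $X\prec_{\log}Y$ means $\prod_{j=1}^k\lambda_j(X)\le\prod_{j=1}^k\lambda_j(Y)$ for $k=1,\dots,n-1$ and $\det X=\det Y$. *)

theory Defs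
  imports Complex_Main "Jordan_Normal_Form.Matrix" "Jordan_Normal_Form.Determinant"
    "Jordan_Normal_Form.Char_Poly"
begin

definition adj :: "complex mat \<Rightarrow> complex mat" where
  "adj A = mat (dim_col A) (dim_row A) (\<lambda>(i,j). cnj (A $$ (j,i)))"

definition hermitian :: "nat \<Rightarrow> complex mat \<Rightarrow> bool" where
  "hermitian n A \<longleftrightarrow> A \<in> carrier_mat n n \<and> adj A = A"

definition unitary :: "nat \<Rightarrow> complex mat \<Rightarrow> bool" where
  "unitary n U \<longleftrightarrow> U \<in> carrier_mat n n \<and> U * adj U = 1\<^sub>m n \<and> adj U * U = 1\<^sub>m n"

definition qform :: "complex mat \<Rightarrow> complex vec \<Rightarrow> complex" where
  "qform A v = (\<Sum>i<dim_vec v. cnj (v $ i) * (A *\<^sub>v v) $ i)"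

definition pos_def :: "nat \<Rightarrow> complex mat \<Rightarrow> bool" where
  "pos_def n A \<longleftrightarrow> hermitian n A \<and>
     (\<forall>v \<in> carrier_vec n. v \<noteq> 0\<^sub>v n \<longrightarrow> Re (qform A v) > 0)"

definition pos_semidef :: "nat \<Rightarrow> complex mat \<Rightarrow> bool" where
  "pos_semidef n A \<longleftrightarrow> hermitian n A \<and>
     (\<forall>v \<in> carrier_vec n. Re (qform A v) \<ge> 0)"

definition rdiag :: "nat \<Rightarrow> (nat \<Rightarrow> real) \<Rightarrow> complex mat" where
  "rdiag n d = mat n n (\<lambda>(i,j). if i = j then complex_of_real (d i) else 0)"

text \<open>Functional calculus for Hermitian matrices: A = U diag(d) U^* gives
  f(A) = U diag(f o d) U^* (independent of the chosen diagonalization).\<close>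
definition mat_fun :: "nat \<Rightarrow> (real \<Rightarrow> real) \<Rightarrow> complex mat \<Rightarrow> complex mat" where
  "mat_fun n f A = (SOME M. \<exists>U d. unitary n U \<and> A = U * rdiag n d * adj U \<and>
                                 M = U * rdiag n (f \<circ> d) * adj U)"

definition mpow :: "nat \<Rightarrow> complex mat \<Rightarrow> real \<Rightarrow> complex mat" where
  "mpow n A r = mat_fun n (\<lambda>x. x powr r) A"

definition gmean :: "nat \<Rightarrow> complex mat \<Rightarrow> complex mat \<Rightarrow> complex mat" where
  "gmean n A B = mpow n A (1/2) *
     mpow n (mpow n A (-1/2) * B * mpow n A (-1/2)) (1/2) * mpow n A (1/2)"

definition spt :: "nat \<Rightarrow> complex mat \<Rightarrow> real \<Rightarrow> complex mat \<Rightarrow> complex mat" where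
  "spt n A t B = mpow n (gmean n (mpow n A (-1)) B) t * A * mpow n (gmean n (mpow n A (-1)) B) t"

text \<open>Eigenvalues (with multiplicity) of a Hermitian matrix, in decreasing order:
  the unique non-increasing real list whose entries are the roots of the
  characteristic polynomial det(xI - A).\<close>
definition eigs :: "complex mat \<Rightarrow> real list" where
  "eigs A = (SOME xs. sorted_wrt (\<ge>) xs \<and>
      char_poly A = (\<Prod>a\<leftarrow>xs. [:- complex_of_real a, 1:]))"

definition eig :: "complex mat \<Rightarrow> nat \<Rightarrow> real" where
  "eig A j = eigs A ! (j - 1)"

definition log_maj :: "nat \<Rightarrow> complex mat \<Rightarrow> complex mat \<Rightarrow> bool" where
  "log_maj n X Y \<longleftrightarrow>
     (\<forall>k \<in> {1..n-1}. (\<Prod>j=1..k. eig X j) \<le> (\<Prod>j=1..k. eig Y j)) \<and> det X = det Y"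

end

theory Submission
  imports Defs
begin

text \<open>
  Fix \<open>k\<close> and let \<open>N X\<close> be the squared product of the \<open>k\<close> largest singular values of \<open>X\<close>, that is,
  the product of the \<open>k\<close> largest eigenvalues of \<open>X\<^sup>*X\<close>. It is the maximum of
  \<open>det (V\<^sup>*X\<^sup>*XV) / det (V\<^sup>*V)\<close> over \<open>n\<times>k\<close> matrices \<open>V\<close>, hence submultiplicative, and it satisfies
  \<open>N (X\<^sup>*X) = (N X)\<^sup>2\<close>. These two properties give \<open>N (XY) \<le> N (YX)\<close> whenever \<open>XY\<close> is Hermitian, and from
  this \<open>x \<mapsto> ln (N (Q\<^sup>x S R\<^sup>x))\<close> is midpoint convex for positive definite \<open>Q\<close>, \<open>R\<close>; being locally
  bounded above, it is convex. In particular \<open>N (Q\<^sup>x R\<^sup>x) \<le> (N (QR))\<^sup>x\<close> for \<open>0 \<le> x \<le> 1\<close>.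

  Put \<open>s = -t\<close>, \<open>G = A\<^sup>-\<^sup>1 # B\<close> (so \<open>GAG = B\<close>), \<open>H = G\<^sup>-\<^sup>1\<close> and \<open>Q = A\<^bsup>-1/(2s)\<^esup>\<close>. Then
  \<open>N (H\<^sup>s A\<^bsup>1/2\<^esup>) \<le> (N (H Q\<^sup>-\<^sup>1))\<^sup>s \<le> (N (Q\<^sup>s H Q\<^bsup>-1-s\<^esup>))\<^sup>s
    = (N (B\<^bsup>-1/2\<^esup> A\<^bsup>(1+s)/(2s)\<^esup>))\<^sup>s \<le> (N (B\<^bsup>-s\<^esup> A\<^bsup>1+s\<^esup>))\<^bsup>1/2\<^esup>\<close>:
  the outer steps need \<open>s \<le> 1\<close> and \<open>1/(2s) \<le> 1\<close>, and the middle one is the convexity of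
  \<open>x \<mapsto> ln (N (Q\<^sup>x H Q\<^bsup>-1-x\<^esup>))\<close>, which is symmetric about \<open>-1/2\<close>.
\<close>

section \<open>Adjoints and real diagonal matrices\<close>

lemma adj_carrier [simp]: "A \<in> carrier_mat m n \<Longrightarrow> adj A \<in> carrier_mat n m"
  by (simp add: adj_def)

lemma dim_adj [simp]: "dim_row (adj A) = dim_col A" "dim_col (adj A) = dim_row A"
  by (simp_all add: adj_def)

lemma index_adj [simp]: "i < dim_col A \<Longrightarrow> j < dim_row A \<Longrightarrow> adj A $$ (i, j) = cnj (A $$ (j, i))"
  by (simp add: adj_def)

lemma adj_adj [simp]: "adj (adj A) = A"
  by (rule eq_matI) auto

lemma adj_one [simp]: "adj (1\<^sub>m n) = 1\<^sub>m n"
  by (rule eq_matI) auto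

lemma adj_mult [simp]: "dim_col A = dim_row B \<Longrightarrow> adj (A * B) = adj B * adj A"
  by (intro eq_matI) (auto simp: scalar_prod_def mult.commute)

lemma mat_assoc: "dim_col A = dim_row B \<Longrightarrow> dim_col B = dim_row C \<Longrightarrow> A * B * C = A * (B * C)"
  by (rule assoc_mult_mat[of A "dim_row A" "dim_row B" B "dim_row C" C "dim_col C"]) auto

lemma mult_square [simp]:
  "A \<in> carrier_mat n n \<Longrightarrow> B \<in> carrier_mat n n \<Longrightarrow> A * B \<in> carrier_mat n n"
  by (rule mult_carrier_mat)

lemma det_adj:
  assumes "A \<in> carrier_mat n n"
  shows "det (adj A) = cnj (det A)"
proof -
  have *: "adj A = map_mat cnj (transpose_mat A)"
    using assms by (intro eq_matI) auto
  have "det (map_mat cnj (transpose_mat A)) = cnj (det (transpose_mat A))"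
  proof -
    interpret comm_ring_hom cnj by standard auto
    show ?thesis by simp
  qed
  then show ?thesis using assms by (simp add: * det_transpose)
qed

lemma rdiag_carrier [simp]: "rdiag n d \<in> carrier_mat n n"
  by (simp add: rdiag_def)

lemma dim_rdiag [simp]: "dim_row (rdiag n d) = n" "dim_col (rdiag n d) = n"
  by (simp_all add: rdiag_def)

lemma index_rdiag [simp]:
  "i < n \<Longrightarrow> j < n \<Longrightarrow> rdiag n d $$ (i, j) = (if i = j then complex_of_real (d i) else 0)"
  by (simp add: rdiag_def)

lemma adj_rdiag [simp]: "adj (rdiag n d) = rdiag n d"
  by (rule eq_matI) auto

lemma rdiag_one: "rdiag n (\<lambda>_. 1) = 1\<^sub>m n"
  by (rule eq_matI) auto

lemma rdiag_mult_index:
  assumes "A \<in> carrier_mat n m" "i < n" "j < m"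
  shows "(rdiag n d * A) $$ (i, j) = complex_of_real (d i) * A $$ (i, j)"
proof -
  have "(rdiag n d * A) $$ (i, j) = (\<Sum>l = 0..<n. (if i = l then complex_of_real (d i) else 0) * A $$ (l, j))"
    using assms by (simp add: scalar_prod_def)
  also have "\<dots> = (\<Sum>l = 0..<n. if i = l then complex_of_real (d i) * A $$ (i, j) else 0)"
    by (intro sum.cong) auto
  also have "\<dots> = complex_of_real (d i) * A $$ (i, j)" using assms by simp
  finally show ?thesis .
qed

lemma mult_rdiag_index:
  assumes "A \<in> carrier_mat m n" "i < m" "j < n"
  shows "(A * rdiag n d) $$ (i, j) = A $$ (i, j) * complex_of_real (d j)"
proof -
  have "(A * rdiag n d) $$ (i, j) = (\<Sum>l = 0..<n. A $$ (i, l) * (if l = j then complex_of_real (d l) else 0))"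
    using assms by (simp add: scalar_prod_def)
  also have "\<dots> = (\<Sum>l = 0..<n. if l = j then A $$ (i, j) * complex_of_real (d j) else 0)"
    by (intro sum.cong) auto
  also have "\<dots> = A $$ (i, j) * complex_of_real (d j)" using assms by simp
  finally show ?thesis .
qed

lemma rdiag_mult: "rdiag n d * rdiag n e = rdiag n (\<lambda>i. d i * e i)"
  by (rule eq_matI) (auto simp: rdiag_mult_index[of _ n n] simp del: index_mult_mat(1))

lemma unitary_carrier [simp]: "unitary n U \<Longrightarrow> U \<in> carrier_mat n n"
  by (simp add: unitary_def)

text \<open>Products are normalised to the right by \<open>mat_assoc\<close>, so a cancelling pair
  \<open>X * Y\<close> shows up in front of a remaining factor; this is the form in which the
  simplifier can remove it.\<close>

lemma mult_cancel_middle: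
  fixes X :: "complex mat"
  assumes "X * Y = 1\<^sub>m n" "dim_col X = dim_row Y" "dim_col Y = n" "dim_row Z = n"
  shows "X * (Y * Z) = Z"
  using assms by (simp flip: mat_assoc)

lemma unitaryD:
  assumes "unitary n U"
  shows "dim_row U = n" "dim_col U = n" "U * adj U = 1\<^sub>m n" "adj U * U = 1\<^sub>m n"
    "\<And>X. dim_row X = n \<Longrightarrow> adj U * (U * X) = X" "\<And>X. dim_row X = n \<Longrightarrow> U * (adj U * X) = X"
  using assms by (auto simp: unitary_def intro!: mult_cancel_middle)

lemma unitary_mult:
  assumes "unitary n U" and "unitary n V"
  shows "unitary n (U * V)"
  using assms by (simp add: unitary_def[of n "U * V"] mat_assoc unitaryD[OF assms(1)] unitaryD[OF assms(2)])

section \<open>The spectral theorem\<close>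

text \<open>The reflection exchanging \<open>v\<close> and the first unit vector; the sign condition on \<open>v 0\<close> keeps
  \<open>v\<close> away from that vector.\<close>

lemma householder:
  fixes v :: "nat \<Rightarrow> complex"
  assumes norm: "(\<Sum>i<Suc n. (cmod (v i))\<^sup>2) = 1" and v0: "v 0 = complex_of_real r" "r \<le> 0"
  obtains U where "unitary (Suc n) U" "\<And>i. i < Suc n \<Longrightarrow> U $$ (i, 0) = v i"
proof -
  let ?N = "Suc n"
  \<comment> \<open>The reflection is \<open>1 - c w w*\<close> with \<open>w = v - e_0\<close>;
    since \<open>w\<close> has squared norm \<open>2 (1 - r)\<close>, the usual factor
    \<open>2 / |w|^2\<close> equals \<open>c = 1 / (1 - r)\<close>.\<close>
  define w where "w i = v i - (if i = 0 then 1 else 0)" for i :: nat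
  define c where "c = 1 / (1 - complex_of_real r)"
  define U where "U = mat ?N ?N (\<lambda>(i,j). (if i = j then 1 else 0) - c * w i * cnj (w j))"
  have cr: "c * (1 - complex_of_real r) = 1" "cnj c = c"
  proof -
    have "1 - complex_of_real r \<noteq> 0" using v0(2) by (metis diff_eq_diff_eq diff_self eq_iff_diff_eq_0 of_real_1 of_real_eq_iff not_one_le_zero)
    then show "c * (1 - complex_of_real r) = 1" "cnj c = c" by (simp_all add: c_def)
  qed
  have S: "(\<Sum>l<?N. cnj (w l) * w l) = 2 * (1 - complex_of_real r)"
  proof -
    have "(\<Sum>l<?N. cnj (w l) * w l) = (\<Sum>l<?N. cnj (v l) * v l - (if l = 0 then 2 * complex_of_real r - 1 else 0))"
      by (rule sum.cong) (auto simp: w_def v0 algebra_simps)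
    also have "\<dots> = (\<Sum>l<?N. cnj (v l) * v l) - (2 * complex_of_real r - 1)"
      unfolding sum_subtractf by (simp add: sum.delta)
    also have "(\<Sum>l<?N. cnj (v l) * v l) = complex_of_real (\<Sum>l<?N. (cmod (v l))\<^sup>2)"
      unfolding of_real_sum by (rule sum.cong) (auto simp: complex_norm_square mult.commute simp del: of_real_power)
    finally show ?thesis unfolding norm by simp
  qed
  have Uc: "U \<in> carrier_mat ?N ?N" by (simp add: U_def)
  have adjU: "adj U = U"
    by (rule eq_matI) (auto simp: U_def cr)
  have UU: "U * U = 1\<^sub>m ?N"
  proof (rule eq_matI)
    fix i j assume "i < dim_row (1\<^sub>m ?N :: complex mat)" "j < dim_col (1\<^sub>m ?N :: complex mat)"
    then have ij: "i < ?N" "j < ?N" by auto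
    have "(U * U) $$ (i,j) = (\<Sum>l<?N. ((if i = l then 1 else 0) - c * w i * cnj (w l)) * ((if l = j then 1 else 0) - c * w l * cnj (w j)))"
      using ij by (simp add: U_def scalar_prod_def lessThan_atLeast0)
    also have "\<dots> = (\<Sum>l<?N. (if i = l then (if i = j then 1 else 0) - c * w i * cnj (w j) else 0)
        - (if l = j then c * w i * cnj (w j) else 0) + c * c * w i * cnj (w j) * (cnj (w l) * w l))"
      by (rule sum.cong) (auto simp: algebra_simps)
    also have "\<dots> = (if i = j then 1 else 0) - 2 * (c * w i * cnj (w j))
        + c * c * w i * cnj (w j) * (\<Sum>l<?N. cnj (w l) * w l)"
      unfolding sum.distrib sum_subtractf sum_distrib_left[symmetric]
      using ij by (simp add: sum.delta sum.delta' del: sum.lessThan_Suc)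
    also have "\<dots> = (if i = j then 1 else 0) - 2 * (c * w i * cnj (w j)) * (1 - c * (1 - complex_of_real r))"
      unfolding S by (simp add: algebra_simps)
    also have "\<dots> = (1\<^sub>m ?N) $$ (i,j)" using ij cr by simp
    finally show "(U * U) $$ (i,j) = (1\<^sub>m ?N) $$ (i,j)" .
  qed (use Uc in auto)
  have "unitary ?N U" using Uc UU by (simp add: unitary_def adjU)
  moreover have "U $$ (i, 0) = v i" if "i < ?N" for i
  proof -
    have "cnj (w 0) = complex_of_real r - 1" by (simp add: w_def v0)
    then have "c * w i * cnj (w 0) = - w i * (c * (1 - complex_of_real r))"
      by (simp only: w_def) (simp add: v0 algebra_simps)
    then show ?thesis using that cr by (auto simp: U_def w_def)
  qed
  ultimately show ?thesis using that by blast
qed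

text \<open>The eigenvector is rescaled to unit length and its phase turned until the first entry is
  real and nonpositive, as \<open>householder\<close> requires.\<close>

lemma eigenvector_normalized:
  fixes A :: "complex mat"
  assumes A: "A \<in> carrier_mat (Suc n) (Suc n)"
  obtains v e r where "v \<in> carrier_vec (Suc n)" "A *\<^sub>v v = e \<cdot>\<^sub>v v"
    "(\<Sum>i<Suc n. (cmod (v $ i))\<^sup>2) = 1" "v $ 0 = complex_of_real r" "r \<le> 0"
proof -
  have "degree (char_poly A) \<noteq> 0"
    using degree_monic_char_poly[OF A] by simp
  then obtain e where "poly (char_poly A) e = 0"
    using fundamental_theorem_of_algebra[of "char_poly A"] by (auto simp: constant_degree)
  then have "eigenvalue A e" using eigenvalue_root_char_poly[OF A] by simp
  then obtain u where u: "u \<in> carrier_vec (Suc n)" "u \<noteq> 0\<^sub>v (Suc n)" "A *\<^sub>v u = e \<cdot>\<^sub>v u"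
    using A by (auto simp: eigenvalue_def eigenvector_def)
  define S where "S = (\<Sum>i<Suc n. (cmod (u $ i))\<^sup>2)"
  have "S > 0"
  proof -
    obtain i where "i < Suc n" "u $ i \<noteq> 0" using u(1,2) by (metis carrier_vecD eq_vecI index_zero_vec)
    then show ?thesis unfolding S_def by (intro sum_pos2[of _ i]) auto
  qed
  \<comment> \<open>The phase that turns \<open>u $ 0\<close> into \<open>- cmod (u $ 0)\<close>; if
    that entry vanishes, any phase will do.\<close>
  define z where "z = (if u $ 0 = 0 then 1 else - cnj (u $ 0) / complex_of_real (cmod (u $ 0)))"
  have z1: "cmod z = 1" by (auto simp: z_def norm_divide)
  have z0: "z * u $ 0 = complex_of_real (- cmod (u $ 0))"
    by (auto simp: z_def complex_norm_square[symmetric] power2_eq_square mult.commute)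
  define a where "a = z / complex_of_real (sqrt S)"
  show ?thesis
  proof (rule that[of "a \<cdot>\<^sub>v u" e "- cmod (u $ 0) / sqrt S"])
    show "A *\<^sub>v (a \<cdot>\<^sub>v u) = e \<cdot>\<^sub>v (a \<cdot>\<^sub>v u)"
      using u A by (simp add: mult_mat_vec[of _ "Suc n" "Suc n"] smult_smult_assoc mult.commute)
    have "(\<Sum>i<Suc n. (cmod ((a \<cdot>\<^sub>v u) $ i))\<^sup>2) = (\<Sum>i<Suc n. (cmod (u $ i))\<^sup>2 / S)"
      using u \<open>S > 0\<close> by (intro sum.cong) (auto simp: a_def norm_mult norm_divide z1 power_mult_distrib power_divide)
    then show "(\<Sum>i<Suc n. (cmod ((a \<cdot>\<^sub>v u) $ i))\<^sup>2) = 1"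
      using \<open>S > 0\<close> by (simp add: S_def flip: sum_divide_distrib del: sum.lessThan_Suc)
    show "(a \<cdot>\<^sub>v u) $ 0 = complex_of_real (- cmod (u $ 0) / sqrt S)"
      using u z0 by (simp add: a_def)
  qed (use u \<open>S > 0\<close> in auto)
qed

lemma hermitian_congruence:
  assumes "hermitian n A" "X \<in> carrier_mat n n"
  shows "hermitian n (adj X * A * X)"
  using assms by (auto simp: hermitian_def mat_assoc)

lemma mult_block_diag:
  fixes P P' V V' :: "complex mat"
  assumes "P \<in> carrier_mat m m" "P' \<in> carrier_mat m m" "V \<in> carrier_mat n n" "V' \<in> carrier_mat n n"
  shows "four_block_mat P (0\<^sub>m m n) (0\<^sub>m n m) V * four_block_mat P' (0\<^sub>m m n) (0\<^sub>m n m) V'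
    = four_block_mat (P * P') (0\<^sub>m m n) (0\<^sub>m n m) (V * V')"
proof -
  have "0\<^sub>m m n * V' = 0\<^sub>m m n" "P * 0\<^sub>m m n = 0\<^sub>m m n" "0\<^sub>m n m * P' = 0\<^sub>m n m"
    "V * 0\<^sub>m n m = 0\<^sub>m n m" "0\<^sub>m m n * 0\<^sub>m n m = (0\<^sub>m m m :: complex mat)"
    "0\<^sub>m n m * 0\<^sub>m m n = (0\<^sub>m n n :: complex mat)" "P * P' \<in> carrier_mat m m" "V * V' \<in> carrier_mat n n"
    using assms by auto
  then show ?thesis
    using assms by (subst mult_four_block_mat[of _ m m _ n _ n _ _ m _ n]) auto
qed

text \<open>Induction by deflation: a unitary \<open>W\<close> with an eigenvector as first column
  makes the first column of \<open>M\<close> a multiple of the first unit vector. Hermitian symmetry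
  clears the first row too, and the induction hypothesis diagonalizes the remaining block.\<close>

lemma hermitian_spectral:
  assumes "hermitian n A"
  shows "\<exists>U d. unitary n U \<and> A = U * rdiag n d * adj U"
  using assms
proof (induction n arbitrary: A)
  case 0
  then show ?case
    by (intro exI[of _ "1\<^sub>m 0"] exI[of _ "\<lambda>_. 0"]) (auto simp: unitary_def hermitian_def)
next
  case (Suc n)
  let ?N = "Suc n"
  have A [simp]: "A \<in> carrier_mat ?N ?N" and adjA: "adj A = A" using Suc.prems by (auto simp: hermitian_def)
  obtain v e r where v: "v \<in> carrier_vec ?N" "A *\<^sub>v v = e \<cdot>\<^sub>v v"
    "(\<Sum>i<Suc n. (cmod (v $ i))\<^sup>2) = 1" "v $ 0 = complex_of_real r" "r \<le> 0"
    using eigenvector_normalized[OF A] by metis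
  obtain W where W: "unitary ?N W" "\<And>i. i < ?N \<Longrightarrow> W $$ (i, 0) = v $ i"
    using householder[of "\<lambda>i. v $ i" n r] v by blast
  have Wc [simp]: "W \<in> carrier_mat ?N ?N" using W by auto
  define M where "M = adj W * A * W"
  have Mc [simp]: "M \<in> carrier_mat ?N ?N" by (simp add: M_def)
  have hM: "hermitian ?N M" unfolding M_def by (rule hermitian_congruence[OF Suc.prems Wc])
  have adjM: "adj M = M" using hM by (simp add: hermitian_def)
  have colW: "col W 0 = v" using W(2) v(1) unitaryD(1,2)[OF W(1)] by (intro eq_vecI) auto
  have "col M 0 = e \<cdot>\<^sub>v unit_vec ?N 0"
  proof -
    have "col M 0 = adj W * A *\<^sub>v col W 0"
      unfolding M_def by (rule col_mult2[of _ ?N ?N _ ?N]) auto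
    also have "\<dots> = adj W *\<^sub>v (A *\<^sub>v v)"
      unfolding colW using v(1) by (intro assoc_mult_mat_vec[of _ ?N ?N _ ?N]) auto
    also have "\<dots> = e \<cdot>\<^sub>v (adj W *\<^sub>v col W 0)"
      unfolding v(2) colW using v(1) by (intro mult_mat_vec[of _ ?N ?N]) auto
    also have "adj W *\<^sub>v col W 0 = col (adj W * W) 0"
      by (rule col_mult2[of _ ?N ?N _ ?N, symmetric]) auto
    also have "\<dots> = unit_vec ?N 0" using W(1) by (simp add: unitary_def)
    finally show ?thesis .
  qed
  then have M0: "M $$ (i, 0) = (if i = 0 then e else 0)" if "i < ?N" for i
    using that Mc by (metis Zero_not_Suc carrier_matD index_col index_smult_vec(1) index_unit_vec(1)
        index_unit_vec(3) less_Suc_eq_0_disj mult.right_neutral mult_zero_right zero_less_Suc)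
  have M0': "M $$ (0, j) = (if j = 0 then cnj e else 0)" if "j < ?N" for j
    using M0[OF that] that adjM Mc by (metis carrier_matD complex_cnj_zero index_adj zero_less_Suc)
  \<comment> \<open>The corner entry of the Hermitian \<open>M\<close> is both \<open>e\<close> and
    \<open>cnj e\<close>, so the eigenvalue is real.\<close>
  have e: "complex_of_real (Re e) = e"
    using M0[of 0] M0'[of 0] by (simp add: complex_eq_iff)
  define M2 where "M2 = mat n n (\<lambda>(i,j). M $$ (Suc i, Suc j))"
  have "hermitian n M2"
  proof -
    have "cnj (M $$ (Suc j, Suc i)) = M $$ (Suc i, Suc j)" if "i < n" "j < n" for i j
      using adjM Mc that by (metis Suc_less_eq carrier_matD index_adj)
    then show ?thesis by (auto simp: hermitian_def M2_def intro!: eq_matI)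
  qed
  from Suc.IH[OF this] obtain V d where V: "unitary n V" "M2 = V * rdiag n d * adj V" by blast
  have Vc [simp]: "V \<in> carrier_mat n n" using V by auto
  let ?z = "0\<^sub>m 1 n :: complex mat" and ?z' = "0\<^sub>m n 1 :: complex mat"
  define X where "X = four_block_mat (1\<^sub>m 1) ?z ?z' V"
  have X_adj: "adj X = four_block_mat (1\<^sub>m 1) ?z ?z' (adj V)"
    unfolding X_def using unitaryD(1,2)[OF V(1)] by (intro eq_matI) auto
  have Xc [simp]: "X \<in> carrier_mat ?N ?N"
    using four_block_carrier_mat[of "1\<^sub>m 1" 1 1 V n n ?z ?z'] by (simp add: X_def)
  have Xu: "unitary ?N X"
    unfolding unitary_def using Xc
    by (simp add: X_adj) (simp add: X_def mult_block_diag unitaryD[OF V(1)])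
  define d' where "d' i = (case i of 0 \<Rightarrow> Re e | Suc j \<Rightarrow> d j)" for i
  have D: "rdiag ?N d' = four_block_mat (mat 1 1 (\<lambda>_. e)) ?z ?z' (rdiag n d)"
    by (intro eq_matI) (auto simp: d'_def e split: nat.splits)
  have "cnj e = e" using M0[of 0] M0'[of 0] by simp
  then have M: "M = four_block_mat (mat 1 1 (\<lambda>_. e)) ?z ?z' M2"
    using M0 M0' carrier_matD[OF Mc] by (intro eq_matI) (auto simp: M2_def)
  have MX: "M = X * rdiag ?N d' * adj X"
    unfolding X_adj D M V(2) unfolding X_def
    by (simp add: mult_block_diag)
  have "A = W * M * adj W"
    unfolding M_def using carrier_matD[OF A] by (simp add: mat_assoc unitaryD[OF W(1)])
  also have "\<dots> = (W * X) * rdiag ?N d' * adj (W * X)"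
    unfolding MX by (simp add: mat_assoc unitaryD[OF W(1)] unitaryD[OF Xu])
  finally show ?case using unitary_mult[OF W(1) Xu] by blast
qed

section \<open>Functional calculus\<close>

text \<open>This makes the choice in \<open>mat_fun\<close> harmless. The matrix
  \<open>W = adj V * U\<close> intertwines the two diagonals, so \<open>W $$ (i,j)\<close> can be
  nonzero only where \<open>d j = e i\<close>; hence it also intertwines their images under
  \<open>f\<close>.\<close>

lemma unitary_diag_fun_unique:
  assumes U: "unitary n U" and V: "unitary n V"
    and eq: "U * rdiag n d * adj U = V * rdiag n e * adj V"
  shows "U * rdiag n (f \<circ> d) * adj U = V * rdiag n (f \<circ> e) * adj V"
proof -
  note [simp] = unitaryD[OF U] unitaryD[OF V]
  define W where "W = adj V * U"
  have W [simp]: "W \<in> carrier_mat n n" "dim_row W = n" "dim_col W = n"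
    using U V by (auto simp: W_def)
  have "adj V * (U * rdiag n d * adj U) * U = adj V * (V * rdiag n e * adj V) * U"
    by (simp only: eq)
  then have "W * rdiag n d = rdiag n e * W" by (simp add: mat_assoc W_def)
  then have *: "W $$ (i,j) * complex_of_real (d j) = complex_of_real (e i) * W $$ (i,j)"
    if "i < n" "j < n" for i j
    using mult_rdiag_index[of W n n i j d] rdiag_mult_index[of W n n i j e] that by simp
  have "W * rdiag n (f \<circ> d) = rdiag n (f \<circ> e) * W"
  proof (rule eq_matI)
    fix i j assume "i < dim_row (rdiag n (f \<circ> e) * W)" "j < dim_col (rdiag n (f \<circ> e) * W)"
    then have ij: "i < n" "j < n" by auto
    have "W $$ (i,j) = 0 \<or> d j = e i" using *[OF ij] by auto
    then have "W $$ (i,j) * complex_of_real ((f \<circ> d) j) = complex_of_real ((f \<circ> e) i) * W $$ (i,j)"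
      by auto
    then show "(W * rdiag n (f \<circ> d)) $$ (i, j) = (rdiag n (f \<circ> e) * W) $$ (i, j)"
      using ij mult_rdiag_index[of W n n i j "f \<circ> d"] rdiag_mult_index[of W n n i j "f \<circ> e"] by simp
  qed auto
  then have "V * (W * rdiag n (f \<circ> d)) * adj U = V * (rdiag n (f \<circ> e) * W) * adj U" by simp
  then show ?thesis by (simp add: mat_assoc W_def)
qed

lemma mat_fun_diag:
  assumes U: "unitary n U"
  shows "mat_fun n f (U * rdiag n d * adj U) = U * rdiag n (f \<circ> d) * adj U"
  unfolding mat_fun_def
proof (rule someI2)
  show "\<exists>U' d'. unitary n U' \<and> U * rdiag n d * adj U = U' * rdiag n d' * adj U' \<and>
      U * rdiag n (f \<circ> d) * adj U = U' * rdiag n (f \<circ> d') * adj U'"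
    using U by blast
  fix M assume "\<exists>U' d'. unitary n U' \<and> U * rdiag n d * adj U = U' * rdiag n d' * adj U' \<and>
      M = U' * rdiag n (f \<circ> d') * adj U'"
  then obtain U' d' where V: "unitary n U'" "U * rdiag n d * adj U = U' * rdiag n d' * adj U'"
      "M = U' * rdiag n (f \<circ> d') * adj U'" by auto
  show "M = U * rdiag n (f \<circ> d) * adj U"
    unfolding V(3) by (rule unitary_diag_fun_unique[OF U V(1,2), symmetric])
qed

section \<open>Quadratic forms and positive definite matrices\<close>

lemma cinner_adj_mult:
  assumes X: "X \<in> carrier_mat n n" and v: "v \<in> carrier_vec n" and u: "u \<in> carrier_vec n"
  shows "(\<Sum>i<n. cnj (v $ i) * (adj X *\<^sub>v u) $ i) = (\<Sum>j<n. cnj ((X *\<^sub>v v) $ j) * u $ j)"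
proof -
  have d: "dim_row X = n" "dim_col X = n" "dim_vec v = n" "dim_vec u = n" using assms by auto
  have "(\<Sum>i<n. cnj (v $ i) * (adj X *\<^sub>v u) $ i) = (\<Sum>i<n. \<Sum>j<n. cnj (v $ i) * cnj (X $$ (j,i)) * u $ j)"
    by (rule sum.cong) (auto simp: d scalar_prod_def sum_distrib_left lessThan_atLeast0 mult.assoc)
  also have "\<dots> = (\<Sum>j<n. \<Sum>i<n. cnj (v $ i) * cnj (X $$ (j,i)) * u $ j)"
    by (rule sum.swap)
  also have "\<dots> = (\<Sum>j<n. cnj ((X *\<^sub>v v) $ j) * u $ j)"
    by (rule sum.cong) (auto simp: d scalar_prod_def lessThan_atLeast0 sum_distrib_left ac_simps)
  finally show ?thesis .
qed

lemma qform_congruence: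
  assumes "A \<in> carrier_mat n n" "X \<in> carrier_mat n n" "v \<in> carrier_vec n"
  shows "qform (adj X * A * X) v = qform A (X *\<^sub>v v)"
proof -
  have "adj X * A * X *\<^sub>v v = adj X *\<^sub>v (A *\<^sub>v (X *\<^sub>v v))"
    using assms by (simp add: assoc_mult_mat_vec[of _ n n _ n] mult_mat_vec_carrier[of _ n n])
  then show ?thesis
    using assms cinner_adj_mult[of X n v "A *\<^sub>v (X *\<^sub>v v)"]
    by (simp add: qform_def mult_mat_vec_carrier[of _ n n])
qed

lemma pos_def_hermitian: "pos_def n A \<Longrightarrow> hermitian n A"
  by (simp add: pos_def_def)

lemma pos_def_carrier: "pos_def n A \<Longrightarrow> A \<in> carrier_mat n n"
  by (simp add: pos_def_def hermitian_def)

lemma pos_def_congruence: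
  assumes A: "pos_def n A" and X: "X \<in> carrier_mat n n" and Y: "Y \<in> carrier_mat n n" "Y * X = 1\<^sub>m n"
  shows "pos_def n (adj X * A * X)"
  unfolding pos_def_def
proof (intro conjI ballI impI)
  show "hermitian n (adj X * A * X)" using A X by (intro hermitian_congruence pos_def_hermitian)
  fix v :: "complex vec" assume v: "v \<in> carrier_vec n" "v \<noteq> 0\<^sub>v n"
  have "X *\<^sub>v v \<noteq> 0\<^sub>v n"
  proof
    assume "X *\<^sub>v v = 0\<^sub>v n"
    then have "Y *\<^sub>v (X *\<^sub>v v) = 0\<^sub>v n" using Y by auto
    moreover have "Y *\<^sub>v (X *\<^sub>v v) = v"
      using assoc_mult_mat_vec[of Y n n X n v] X Y v by simp
    ultimately show False using v by simp
  qed
  then show "Re (qform (adj X * A * X) v) > 0"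
    using A X v qform_congruence[OF pos_def_carrier[OF A] X v(1)]
    by (simp add: pos_def_def mult_mat_vec_carrier[of _ n n])
qed

lemma qform_rdiag:
  assumes "v \<in> carrier_vec n"
  shows "Re (qform (rdiag n d) v) = (\<Sum>i<n. d i * (cmod (v $ i))\<^sup>2)"
proof -
  have "(rdiag n d *\<^sub>v v) $ i = complex_of_real (d i) * v $ i" if "i < n" for i
  proof -
    have "(rdiag n d *\<^sub>v v) $ i = (\<Sum>l = 0..<n. (if i = l then complex_of_real (d i) else 0) * v $ l)"
      using that assms by (simp add: scalar_prod_def)
    also have "\<dots> = (\<Sum>l = 0..<n. if i = l then complex_of_real (d i) * v $ i else 0)"
      by (intro sum.cong) auto
    finally show ?thesis using that by simp
  qed
  then have "qform (rdiag n d) v = (\<Sum>i<n. complex_of_real (d i * (cmod (v $ i))\<^sup>2))"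
    using assms unfolding qform_def
    by (intro sum.cong) (auto simp: complex_norm_square simp del: of_real_power)
  then show ?thesis by (simp del: of_real_mult of_real_power)
qed

lemma pos_def_rdiag_iff: "pos_def n (rdiag n d) \<longleftrightarrow> (\<forall>i<n. d i > 0)"
proof
  assume pd: "pos_def n (rdiag n d)"
  show "\<forall>i<n. d i > 0"
  proof (intro allI impI)
    fix i assume i: "i < n"
    have "(\<Sum>j<n. d j * (cmod (unit_vec n i $ j))\<^sup>2) = (\<Sum>j<n. if j = i then d i else 0)"
      by (rule sum.cong) (use i in auto)
    moreover have "Re (qform (rdiag n d) (unit_vec n i)) > 0"
      using pd i by (simp add: pos_def_def unit_vec_nonzero)
    ultimately show "d i > 0" using i by (simp add: qform_rdiag)
  qed
next
  assume d: "\<forall>i<n. d i > 0"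
  show "pos_def n (rdiag n d)"
    unfolding pos_def_def hermitian_def
  proof (intro conjI ballI impI)
    fix v :: "complex vec" assume v: "v \<in> carrier_vec n" "v \<noteq> 0\<^sub>v n"
    then obtain i where "i < n" "v $ i \<noteq> 0"
      by (metis carrier_vecD eq_vecI index_zero_vec)
    then show "Re (qform (rdiag n d) v) > 0"
      using d unfolding qform_rdiag[OF v(1)] by (intro sum_pos2[of _ i]) (auto intro: less_imp_le)
  qed auto
qed

lemma pos_def_diag_iff:
  assumes U: "unitary n U"
  shows "pos_def n (U * rdiag n d * adj U) \<longleftrightarrow> (\<forall>i<n. d i > 0)"
proof -
  have c: "U \<in> carrier_mat n n" "adj U \<in> carrier_mat n n" using U by auto
  have "rdiag n d = adj U * (U * rdiag n d * adj U) * U"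
    by (simp add: mat_assoc unitaryD[OF U])
  then have "pos_def n (U * rdiag n d * adj U) \<longleftrightarrow> pos_def n (rdiag n d)"
    using pos_def_congruence[of n "rdiag n d" "adj U" U] pos_def_congruence[of n "U * rdiag n d * adj U" U "adj U"]
      c unitaryD(3,4)[OF U] by auto
  then show ?thesis by (simp add: pos_def_rdiag_iff)
qed

lemma pos_def_spectral:
  assumes "pos_def n A"
  obtains U d where "unitary n U" "\<And>i. i < n \<Longrightarrow> d i > 0" "A = U * rdiag n d * adj U"
  using hermitian_spectral[OF pos_def_hermitian[OF assms]] assms pos_def_diag_iff by metis

section \<open>Real powers of positive definite matrices\<close>

lemma mpow_diag:
  assumes "unitary n U"
  shows "mpow n (U * rdiag n d * adj U) r = U * rdiag n (\<lambda>i. d i powr r) * adj U"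
  using mat_fun_diag[OF assms, of "\<lambda>x. x powr r" d] by (simp add: mpow_def comp_def)

lemma rdiag_cong: "(\<And>i. i < n \<Longrightarrow> d i = e i) \<Longrightarrow> rdiag n d = rdiag n e"
  by (rule eq_matI) auto

lemma pos_def_mpow [simp]:
  assumes "pos_def n A"
  shows "pos_def n (mpow n A r)"
proof -
  obtain U d where "unitary n U" "\<And>i. i < n \<Longrightarrow> d i > 0" "A = U * rdiag n d * adj U"
    using pos_def_spectral[OF assms] by metis
  then show ?thesis by (auto simp: mpow_diag pos_def_diag_iff) (metis less_irrefl)
qed

lemma mpow_add:
  assumes "pos_def n A"
  shows "mpow n A x * mpow n A y = mpow n A (x + y)"
proof -
  obtain U d where U: "unitary n U" "A = U * rdiag n d * adj U"
    using pos_def_spectral[OF assms] by metis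
  have "mpow n A x * mpow n A y = U * (rdiag n (\<lambda>i. d i powr x) * rdiag n (\<lambda>i. d i powr y)) * adj U"
    unfolding U(2) mpow_diag[OF U(1)] by (simp add: mat_assoc unitaryD[OF U(1)])
  then show ?thesis by (simp add: rdiag_mult U(2) mpow_diag[OF U(1)] powr_add)
qed

lemma mpow_0:
  assumes "pos_def n A"
  shows "mpow n A 0 = 1\<^sub>m n"
proof -
  obtain U d where U: "unitary n U" "\<And>i. i < n \<Longrightarrow> d i > 0" "A = U * rdiag n d * adj U"
    using pos_def_spectral[OF assms] by metis
  \<comment> \<open>In Isabelle \<open>0 powr 0 = 0\<close>, so positivity of the eigenvalues enters
    here.\<close>
  have "rdiag n (\<lambda>i. d i powr 0) = rdiag n (\<lambda>_. 1)"
    by (rule rdiag_cong) (use U(2) in force)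
  then show ?thesis by (simp add: U(3) mpow_diag[OF U(1)] rdiag_one unitaryD[OF U(1)])
qed

lemma mpow_1:
  assumes "pos_def n A"
  shows "mpow n A 1 = A"
proof -
  obtain U d where U: "unitary n U" "\<And>i. i < n \<Longrightarrow> d i > 0" "A = U * rdiag n d * adj U"
    using pos_def_spectral[OF assms] by metis
  have "rdiag n (\<lambda>i. d i powr 1) = rdiag n d"
    by (rule rdiag_cong) (use U(2) in \<open>simp add: less_imp_le\<close>)
  then show ?thesis by (simp add: U(3) mpow_diag[OF U(1)])
qed

lemma mpow_mpow:
  assumes "pos_def n A"
  shows "mpow n (mpow n A x) y = mpow n A (x * y)"
proof -
  obtain U d where U: "unitary n U" "A = U * rdiag n d * adj U"
    using pos_def_spectral[OF assms] by metis
  show ?thesis by (simp add: U(2) mpow_diag[OF U(1)] powr_powr)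
qed

lemma det_rdiag: "det (rdiag n d) = (\<Prod>i<n. complex_of_real (d i))"
  by (subst det_upper_triangular[of _ n])
     (auto simp: prod_list_diag_prod lessThan_atLeast0 upper_triangular_def)

lemma det_diag:
  assumes U: "unitary n U"
  shows "det (U * rdiag n d * adj U) = (\<Prod>i<n. complex_of_real (d i))"
proof -
  have c: "U \<in> carrier_mat n n" "adj U \<in> carrier_mat n n" using U by auto
  have "det U * det (adj U) = 1"
    using det_mult[OF c] by (simp add: unitaryD[OF U])
  then show ?thesis using c
    by (simp add: det_rdiag det_mult[of _ n] mult_square[of _ n])
qed

lemma det_pos_def:
  assumes "pos_def n A"
  shows "det A = complex_of_real (Re (det A))" "Re (det A) > 0"
    "det (mpow n A r) = complex_of_real (Re (det A) powr r)"
proof -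
  obtain U d where U: "unitary n U" "\<And>i. i < n \<Longrightarrow> d i > 0" "A = U * rdiag n d * adj U"
    using pos_def_spectral[OF assms] by metis
  have 1: "det A = complex_of_real (\<Prod>i<n. d i)" by (simp add: U(3) det_diag[OF U(1)])
  then show "det A = complex_of_real (Re (det A))" by simp
  show "Re (det A) > 0" unfolding 1 Re_complex_of_real using U(2) by (intro prod_pos) auto
  have "(\<Prod>i<n. d i powr r) = (\<Prod>i<n. d i) powr r"
    using U(2) by (simp add: prod_powr_distrib less_imp_le)
  then show "det (mpow n A r) = complex_of_real (Re (det A) powr r)"
    unfolding 1 by (simp add: U(3) mpow_diag[OF U(1)] det_diag[OF U(1)] flip: of_real_prod)
qed

section \<open>Determinants of compressions\<close>

text \<open>Each row of \<open>A * B\<close> is a combination of rows of \<open>B\<close>, and the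
  determinant is linear in every row. The maps \<open>f\<close> pick one row of \<open>B\<close> per
  position; fixing them to the identity outside \<open>{0..<k}\<close> makes each choice correspond
  to exactly one function.\<close>

lemma det_mult_expand_rows:
  fixes A B :: "complex mat"
  assumes A: "A \<in> carrier_mat k n" and B: "B \<in> carrier_mat n k"
  shows "det (A * B) = (\<Sum>f \<in> {f. (\<forall>i\<in>{0..<k}. f i \<in> {0..<n}) \<and> (\<forall>i. i \<notin> {0..<k} \<longrightarrow> f i = i)}.
    (\<Prod>i = 0..<k. A $$ (i, f i)) * det (mat k k (\<lambda>(i,j). B $$ (f i, j))))" (is "_ = sum ?g ?F")
proof -
  have "det (A * B) = det (mat\<^sub>r k k (\<lambda>i. finsum_vec TYPE(complex) k (\<lambda>l. A $$ (i,l) \<cdot>\<^sub>v row B l) {0..<n}))"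
    by (subst mat_mul_finsum_alt[OF A B]) simp
  also have "\<dots> = (\<Sum>f\<in>?F. det (mat\<^sub>r k k (\<lambda>i. A $$ (i, f i) \<cdot>\<^sub>v row B (f i))))"
    by (rule det_linear_rows_sum) (use B in auto)
  also have "\<dots> = sum ?g ?F"
  proof (rule sum.cong)
    fix f assume f: "f \<in> ?F"
    have "det (mat\<^sub>r k k (\<lambda>i. A $$ (i, f i) \<cdot>\<^sub>v row B (f i)))
        = (\<Prod>i = 0..<k. A $$ (i, f i)) * det (mat\<^sub>r k k (\<lambda>i. row B (f i)))"
      by (rule det_rows_mul) (use B in auto)
    also have "mat\<^sub>r k k (\<lambda>i. row B (f i)) = mat k k (\<lambda>(i,j). B $$ (f i, j))"
      using f B by (intro eq_matI) auto
    finally show "det (mat\<^sub>r k k (\<lambda>i. A $$ (i, f i) \<cdot>\<^sub>v row B (f i))) = ?g f" .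
  qed simp
  finally show ?thesis .
qed

text \<open>Summing over all index maps instead of over \<open>k\<close>-subsets counts every minor \<open>k!\<close> times.\<close>

lemma cauchy_binet_maps:
  fixes A B :: "complex mat"
  assumes A: "A \<in> carrier_mat k n" and B: "B \<in> carrier_mat n k"
  shows "of_nat (fact k) * det (A * B) =
    (\<Sum>f \<in> {f. (\<forall>i\<in>{0..<k}. f i \<in> {0..<n}) \<and> (\<forall>i. i \<notin> {0..<k} \<longrightarrow> f i = i)}.
      det (mat k k (\<lambda>(i,j). A $$ (i, f j))) * det (mat k k (\<lambda>(i,j). B $$ (f i, j))))"
proof -
  let ?F = "{f. (\<forall>i\<in>{0..<k}. f i \<in> {0..<n}) \<and> (\<forall>i. i \<notin> {0..<k} \<longrightarrow> f i = i)}"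
  let ?P = "{p. p permutes {0..<k}}"
  let ?B = "\<lambda>f. mat k k (\<lambda>(i,j). B $$ (f i, j))"
  \<comment> \<open>For one fixed \<open>p\<close>, reindexing by \<open>f o p\<close> permutes the
    rows of the minor of \<open>B\<close> and produces the sign. Summing over all \<open>p\<close>
    then assembles the signed products into the minor of \<open>A\<close>.\<close>
  have perm: "det (A * B) = (\<Sum>f\<in>?F. signof p * (\<Prod>i = 0..<k. A $$ (i, f (p i))) * det (?B f))"
    if p: "p permutes {0..<k}" for p
  proof -
    have pi: "p i < k" if "i < k" for i using permutes_in_image[OF p, of i] that by simp
    have comp_in: "f \<circ> q \<in> ?F" if "f \<in> ?F" "q permutes {0..<k}" for f q
      using that permutes_in_image[OF that(2)] by (auto simp: permutes_not_in)
    have "det (A * B) = (\<Sum>f\<in>?F. (\<Prod>i = 0..<k. A $$ (i, f i)) * det (?B f))"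
      by (rule det_mult_expand_rows[OF A B])
    also have "\<dots> = (\<Sum>f\<in>?F. (\<Prod>i = 0..<k. A $$ (i, (f \<circ> p) i)) * det (?B (f \<circ> p)))"
      by (rule sum.reindex_bij_witness[of _ "\<lambda>f. f \<circ> p" "\<lambda>f. f \<circ> Hilbert_Choice.inv p"])
         (use comp_in p permutes_inv[OF p] in \<open>auto simp: o_assoc[symmetric] permutes_inv_o[OF p]\<close>)
    also have "\<dots> = (\<Sum>f\<in>?F. signof p * (\<Prod>i = 0..<k. A $$ (i, f (p i))) * det (?B f))"
    proof (rule sum.cong)
      fix f
      have "?B (f \<circ> p) = mat k k (\<lambda>(i,j). ?B f $$ (p i, j))"
        by (rule eq_matI) (auto simp: pi)
      then have "det (?B (f \<circ> p)) = signof p * det (?B f)"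
        by (simp only:) (rule det_permute_rows[OF _ p], simp)
      then show "(\<Prod>i = 0..<k. A $$ (i, (f \<circ> p) i)) * det (?B (f \<circ> p))
          = signof p * (\<Prod>i = 0..<k. A $$ (i, f (p i))) * det (?B f)"
        by simp
    qed simp
    finally show ?thesis .
  qed
  have "of_nat (fact k) * det (A * B) = (\<Sum>p\<in>?P. det (A * B))"
    by (simp add: card_permutations[of "{0..<k}" k])
  also have "\<dots> = (\<Sum>p\<in>?P. \<Sum>f\<in>?F. signof p * (\<Prod>i = 0..<k. A $$ (i, f (p i))) * det (?B f))"
    by (rule sum.cong) (use perm in auto)
  also have "\<dots> = (\<Sum>f\<in>?F. \<Sum>p\<in>?P. signof p * (\<Prod>i = 0..<k. A $$ (i, f (p i))) * det (?B f))"
    by (rule sum.swap)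
  also have "\<dots> = (\<Sum>f\<in>?F. det (mat k k (\<lambda>(i,j). A $$ (i, f j))) * det (?B f))"
  proof (rule sum.cong)
    fix f
    have "det (mat k k (\<lambda>(i,j). A $$ (i, f j))) = (\<Sum>p\<in>?P. signof p * (\<Prod>i = 0..<k. A $$ (i, f (p i))))"
      by (subst det_def'[of _ k])
         (auto intro!: sum.cong prod.cong arg_cong2[of _ _ _ _ "(*)"] dest: permutes_in_image)
    then show "(\<Sum>p\<in>?P. signof p * (\<Prod>i = 0..<k. A $$ (i, f (p i))) * det (?B f))
        = det (mat k k (\<lambda>(i,j). A $$ (i, f j))) * det (?B f)"
      by (simp add: sum_distrib_right)
  qed simp
  finally show ?thesis .
qed

text \<open>Induction removing the largest index \<open>m\<close>: a set of \<open>k + 1\<close>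
  indices below or equal to \<open>m\<close> forces \<open>k <= m\<close>, so \<open>d m\<close> is
  at most \<open>d k\<close>.\<close>

lemma prod_le_prod_initial:
  fixes d :: "nat \<Rightarrow> real"
  assumes "finite S" "card S = k" "S \<subseteq> {..<n}" "\<And>i. i < n \<Longrightarrow> 0 \<le> d i" "\<And>i j. i \<le> j \<Longrightarrow> j < n \<Longrightarrow> d j \<le> d i"
  shows "prod d S \<le> (\<Prod>i<k. d i)"
  using assms(1-3)
proof (induction k arbitrary: S)
  case 0
  then show ?case by simp
next
  case (Suc k)
  define m where "m = Max S"
  have ne: "S \<noteq> {}" using Suc.prems by auto
  have m: "m \<in> S" unfolding m_def using Suc.prems ne by auto
  have "S \<subseteq> {..m}" using Suc.prems by (auto simp: m_def)
  then have "card S \<le> Suc m" using card_mono[of "{..m}" S] by simp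
  then have km: "k \<le> m" "m < n" using Suc.prems m by auto
  have "prod d S = d m * prod d (S - {m})" using Suc.prems m by (simp add: prod.remove)
  also have "\<dots> \<le> d k * (\<Prod>i<k. d i)"
  proof (rule mult_mono)
    show "prod d (S - {m}) \<le> (\<Prod>i<k. d i)"
      using Suc.prems m by (intro Suc.IH) auto
    show "0 \<le> prod d (S - {m})" using Suc.prems assms(4) by (intro prod_nonneg) auto
  qed (use km assms(4,5) in auto)
  finally show ?case by (simp add: mult.commute)
qed

text \<open>By Cauchy-Binet, \<open>k!\<close> times the left determinant is a sum of squared moduli
  of minors of \<open>V\<close>, weighted by products of the selected \<open>d i\<close>. Selections
  with a repeated row contribute zero, and every other weight is at most the product of the first
  \<open>k\<close> entries. Weights equal to 1 give \<open>adj V * V\<close>, which is why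
  \<open>key\<close> is stated for arbitrary \<open>e\<close>.\<close>

lemma det_compression_le:
  fixes d :: "nat \<Rightarrow> real"
  assumes V: "V \<in> carrier_mat n k" and pos: "\<And>i. i < n \<Longrightarrow> 0 \<le> d i"
    and anti: "\<And>i j. i \<le> j \<Longrightarrow> j < n \<Longrightarrow> d j \<le> d i"
  shows "Re (det (adj V * (rdiag n d * V))) \<le> (\<Prod>i<k. d i) * Re (det (adj V * V))"
proof -
  let ?F = "{f. (\<forall>i\<in>{0..<k}. f i \<in> {0..<n}) \<and> (\<forall>i. i \<notin> {0..<k} \<longrightarrow> f i = i)}"
  let ?V = "\<lambda>f. mat k k (\<lambda>(i,j). V $$ (f i, j))"
  have key: "of_nat (fact k) * det (adj V * (rdiag n e * V)) =
      complex_of_real (\<Sum>f\<in>?F. (\<Prod>i = 0..<k. e (f i)) * (cmod (det (?V f)))\<^sup>2)" for e :: "nat \<Rightarrow> real"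
  proof -
    have c: "rdiag n e * V \<in> carrier_mat n k" using V by auto
    have "of_nat (fact k) * det (adj V * (rdiag n e * V)) = (\<Sum>f\<in>?F. det (mat k k (\<lambda>(i,j). adj V $$ (i, f j))) *
        det (mat k k (\<lambda>(i,j). (rdiag n e * V) $$ (f i, j))))"
      by (rule cauchy_binet_maps) (use V c in auto)
    also have "\<dots> = (\<Sum>f\<in>?F. complex_of_real ((\<Prod>i = 0..<k. e (f i)) * (cmod (det (?V f)))\<^sup>2))"
    proof (rule sum.cong)
      fix f assume f: "f \<in> ?F"
      have 1: "mat k k (\<lambda>(i,j). adj V $$ (i, f j)) = adj (?V f)"
        using f V by (intro eq_matI) auto
      have "mat k k (\<lambda>(i,j). (rdiag n e * V) $$ (f i, j)) = mat\<^sub>r k k (\<lambda>i. complex_of_real (e (f i)) \<cdot>\<^sub>v row (?V f) i)"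
        using f V by (intro eq_matI) (auto simp: rdiag_mult_index[OF V] simp del: index_mult_mat(1))
      then have "det (mat k k (\<lambda>(i,j). (rdiag n e * V) $$ (f i, j)))
          = (\<Prod>i = 0..<k. complex_of_real (e (f i))) * det (mat\<^sub>r k k (\<lambda>i. row (?V f) i))"
        by (simp only:) (rule det_rows_mul, auto)
      also have "mat\<^sub>r k k (\<lambda>i. row (?V f) i) = ?V f"
        by (intro eq_matI) auto
      finally show "det (mat k k (\<lambda>(i,j). adj V $$ (i, f j))) * det (mat k k (\<lambda>(i,j). (rdiag n e * V) $$ (f i, j)))
          = complex_of_real ((\<Prod>i = 0..<k. e (f i)) * (cmod (det (?V f)))\<^sup>2)"
        unfolding 1 by (subst det_adj[of _ k])
          (auto simp: complex_norm_square mult_ac simp del: of_real_power)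
    qed simp
    finally show ?thesis by (simp only: of_real_sum)
  qed
  have keyR: "fact k * Re (det (adj V * (rdiag n e * V))) =
      (\<Sum>f\<in>?F. (\<Prod>i = 0..<k. e (f i)) * (cmod (det (?V f)))\<^sup>2)" for e :: "nat \<Rightarrow> real"
    using arg_cong[OF key[of e], of Re] unfolding Re_complex_of_real by simp
  have "fact k * Re (det (adj V * (rdiag n d * V))) \<le> (\<Sum>f\<in>?F. (\<Prod>i<k. d i) * (cmod (det (?V f)))\<^sup>2)"
    unfolding keyR
  proof (rule sum_mono)
    fix f assume f: "f \<in> ?F"
    show "(\<Prod>i = 0..<k. d (f i)) * (cmod (det (?V f)))\<^sup>2 \<le> (\<Prod>i<k. d i) * (cmod (det (?V f)))\<^sup>2"
    proof (cases "inj_on f {0..<k}")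
      case True
      have "(\<Prod>i = 0..<k. d (f i)) = prod d (f ` {0..<k})"
        using True by (simp add: prod.reindex)
      also have "\<dots> \<le> (\<Prod>i<k. d i)"
        by (rule prod_le_prod_initial[where n = n]) (use f True pos anti in \<open>auto simp: card_image\<close>)
      finally show ?thesis by (intro mult_right_mono) auto
    next
      case False
      then obtain i j where "i < k" "j < k" "i \<noteq> j" "f i = f j" by (auto simp: inj_on_def)
      then have "det (?V f) = 0"
        by (intro det_identical_rows[of _ k i j]) (auto simp: row_def)
      then show ?thesis by simp
    qed
  qed
  also have "\<dots> = (\<Prod>i<k. d i) * (fact k * Re (det (adj V * V)))"
    using keyR[of "\<lambda>_. 1"] V by (simp add: rdiag_one sum_distrib_left)
  finally have "fact k * Re (det (adj V * (rdiag n d * V))) \<le> fact k * ((\<Prod>i<k. d i) * Re (det (adj V * V)))"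
    by (simp add: mult_ac)
  then show ?thesis by simp
qed

section \<open>Ordered eigenvalues\<close>

lemma proots_linear_factors:
  fixes xs :: "'a :: idom list"
  shows "proots (\<Prod>a\<leftarrow>xs. [:- a, 1:]) = mset xs"
proof (induction xs)
  case (Cons a xs)
  have "(\<Prod>a\<leftarrow>xs. [:- a, 1:]) \<noteq> 0" by (auto simp: prod_list_zero_iff)
  then show ?case
    using Cons proots_mult[of "[:- a, 1:]" "\<Prod>a\<leftarrow>xs. [:- a, 1:]"] by (simp del: mult_pCons_left)
qed simp

lemma sorted_desc_unique:
  fixes xs ys :: "real list"
  assumes "sorted_wrt (\<ge>) xs" "sorted_wrt (\<ge>) ys" "mset xs = mset ys"
  shows "xs = ys"
proof -
  have "sorted (rev xs)" "sorted (rev ys)" using assms(1,2) by (simp_all add: sorted_wrt_rev)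
  then have "rev xs = rev ys"
    using assms(3) by (metis mset_rev properties_for_sort)
  then show ?thesis by simp
qed

lemma similar_mat_diag:
  assumes "unitary n U"
  shows "similar_mat (U * rdiag n d * adj U) (rdiag n d)"
  unfolding similar_mat_def similar_mat_wit_def
  using assms by (intro exI[of _ U] exI[of _ "adj U"]) (auto simp: Let_def unitaryD[OF assms])

text \<open>The choice in \<open>eigs\<close> is resolved by uniqueness: the linear factors
  determine the multiset of roots, and the ordering then determines the list.\<close>

lemma eigs_diag:
  assumes U: "unitary n U" and anti: "\<And>i j. i \<le> j \<Longrightarrow> j < n \<Longrightarrow> d j \<le> d i"
  shows "eigs (U * rdiag n d * adj U) = map d [0..<n]"
proof -
  let ?A = "U * rdiag n d * adj U"
  have "char_poly ?A = char_poly (rdiag n d)"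
    by (rule char_poly_similar[OF similar_mat_diag[OF U]])
  also have "\<dots> = (\<Prod>a \<leftarrow> diag_mat (rdiag n d). [:- a, 1:])"
    by (rule char_poly_upper_triangular[of _ n]) (auto simp: upper_triangular_def)
  also have "diag_mat (rdiag n d) = map complex_of_real (map d [0..<n])"
    by (auto simp: diag_mat_def)
  finally have cp: "char_poly ?A = (\<Prod>a\<leftarrow>map complex_of_real (map d [0..<n]). [:- a, 1:])" .
  have sorted: "sorted_wrt (\<ge>) (map d [0..<n])"
    using anti by (auto simp: sorted_wrt_iff_nth_less)
  show ?thesis
    unfolding eigs_def
  proof (rule some_equality)
    show "sorted_wrt (\<ge>) (map d [0..<n]) \<and> char_poly ?A = (\<Prod>a\<leftarrow>map d [0..<n]. [:- complex_of_real a, 1:])"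
      using sorted cp by (simp add: comp_def)
    fix xs assume xs: "sorted_wrt (\<ge>) xs \<and> char_poly ?A = (\<Prod>a\<leftarrow>xs. [:- complex_of_real a, 1:])"
    then have "char_poly ?A = (\<Prod>a\<leftarrow>map complex_of_real xs. [:- a, 1:])" by (simp add: comp_def)
    then have "mset (map complex_of_real xs) = mset (map complex_of_real (map d [0..<n]))"
      using cp by (metis proots_linear_factors)
    then have "image_mset Re (image_mset complex_of_real (mset xs))
        = image_mset Re (image_mset complex_of_real (mset (map d [0..<n])))"
      by (simp only: mset_map)
    then have "mset xs = mset (map d [0..<n])"
      by (simp add: multiset.map_comp comp_def)
    then show "xs = map d [0..<n]" using xs sorted by (intro sorted_desc_unique) auto
  qed
qed

text \<open>Sorting the eigenvalues is a permutation \<open>p\<close> of the indices; permuting the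
  columns of \<open>U\<close> by \<open>p\<close> leaves the product unchanged.\<close>

lemma hermitian_spectral_sorted:
  assumes "hermitian n A"
  obtains U d where "unitary n U" "\<And>i j. i \<le> j \<Longrightarrow> j < n \<Longrightarrow> d j \<le> d i" "A = U * rdiag n d * adj U"
proof -
  obtain U d where U: "unitary n U" "A = U * rdiag n d * adj U"
    using hermitian_spectral[OF assms] by blast
  have Uc: "U \<in> carrier_mat n n" and Ud: "dim_row U = n" "dim_col U = n" using U(1) by (auto simp: unitaryD)
  define ys where "ys = rev (sort (map d [0..<n]))"
  have "mset ys = mset (map d [0..<n])" by (simp add: ys_def)
  then obtain p where p: "p permutes {..<n}" "permute_list p (map d [0..<n]) = ys"
    using mset_eq_permutation[of ys "map d [0..<n]"] by auto
  have pi: "p i < n" if "i < n" for i using permutes_in_image[OF p(1), of i] that by simp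
  have ys: "ys ! i = d (p i)" if "i < n" for i
    using p(2)[symmetric] that pi[OF that] by (simp add: permute_list_def)
  have len: "length ys = n" by (simp add: ys_def)
  have sorted: "sorted_wrt (\<ge>) ys" by (simp add: ys_def sorted_wrt_rev)
  define W where "W = mat n n (\<lambda>(i,j). U $$ (i, p j))"
  have Wc [simp]: "W \<in> carrier_mat n n" "dim_row W = n" "dim_col W = n" by (simp_all add: W_def)
  have W_index: "W $$ (i, j) = U $$ (i, p j)" if "i < n" "j < n" for i j using that by (simp add: W_def)
  have sum_p: "(\<Sum>l = 0..<n. g (p l)) = (\<Sum>l = 0..<n. g l)" for g :: "nat \<Rightarrow> complex"
    using sum.permute[OF p(1), of g] by (simp add: lessThan_atLeast0 comp_def)
  have diag: "W * rdiag n (\<lambda>i. e (p i)) * adj W = U * rdiag n e * adj U" for e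
  proof (rule eq_matI)
    fix i j assume "i < dim_row (U * rdiag n e * adj U)" "j < dim_col (U * rdiag n e * adj U)"
    then have ij: "i < n" "j < n" using Ud by auto
    have "(W * rdiag n (\<lambda>i. e (p i)) * adj W) $$ (i,j)
        = (\<Sum>l = 0..<n. (W * rdiag n (\<lambda>i. e (p i))) $$ (i,l) * cnj (W $$ (j,l)))"
      using ij Wc by (subst index_mult_mat(1)) (auto simp: scalar_prod_def simp del: index_mult_mat(1))
    also have "\<dots> = (\<Sum>l = 0..<n. U $$ (i, p l) * complex_of_real (e (p l)) * cnj (U $$ (j, p l)))"
      using ij by (intro sum.cong) (auto simp: mult_rdiag_index[OF Wc(1)] W_index pi simp del: index_mult_mat(1))
    also have "\<dots> = (\<Sum>l = 0..<n. U $$ (i, l) * complex_of_real (e l) * cnj (U $$ (j, l)))"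
      by (rule sum_p)
    also have "\<dots> = (\<Sum>l = 0..<n. (U * rdiag n e) $$ (i,l) * cnj (U $$ (j,l)))"
      using ij by (intro sum.cong) (auto simp: mult_rdiag_index[OF Uc] simp del: index_mult_mat(1))
    also have "\<dots> = (U * rdiag n e * adj U) $$ (i,j)"
      using ij Ud by (subst index_mult_mat(1)) (auto simp: scalar_prod_def simp del: index_mult_mat(1))
    finally show "(W * rdiag n (\<lambda>i. e (p i)) * adj W) $$ (i,j) = (U * rdiag n e * adj U) $$ (i,j)" .
  qed (use Ud in \<open>auto simp: W_def\<close>)
  \<comment> \<open>The identity \<open>diag\<close> with all weights equal to 1 yields unitarity of
    \<open>W\<close>.\<close>
  have "W * adj W = 1\<^sub>m n"
    using diag[of "\<lambda>_. 1"] Wc by (simp add: rdiag_one unitaryD[OF U(1)])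
  moreover then have "adj W * W = 1\<^sub>m n"
    by (intro mat_mult_left_right_inverse[of W n]) auto
  ultimately have "unitary n W" by (simp add: unitary_def)
  moreover have "d (p j) \<le> d (p i)" if "i \<le> j" "j < n" for i j
    using sorted_wrt_nth_less[OF sorted, of i j] that len ys[of i] ys[of j] by (cases "i = j") auto
  moreover have "A = W * rdiag n (\<lambda>i. d (p i)) * adj W" using diag[of d] U(2) by simp
  ultimately show ?thesis using that[of W "\<lambda>i. d (p i)"] by blast
qed

definition eigprod :: "nat \<Rightarrow> complex mat \<Rightarrow> real" where
  "eigprod k A = (\<Prod>j = 1..k. eig A j)"

lemma eigprod_diag:
  assumes U: "unitary n U" and anti: "\<And>i j. i \<le> j \<Longrightarrow> j < n \<Longrightarrow> d j \<le> d i" and k: "k \<le> n"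
  shows "eigprod k (U * rdiag n d * adj U) = (\<Prod>i<k. d i)"
proof -
  have "eigs (U * rdiag n d * adj U) = map d [0..<n]" by (rule eigs_diag[OF U anti])
  then have "eigprod k (U * rdiag n d * adj U) = (\<Prod>j = 1..k. d (j - 1))"
    unfolding eigprod_def eig_def by (intro prod.cong) (use k in auto)
  also have "\<dots> = (\<Prod>i<k. d i)"
    by (rule prod.reindex_bij_witness[of _ Suc "\<lambda>j. j - 1"]) auto
  finally show ?thesis .
qed

lemma pos_def_spectral_sorted:
  assumes "pos_def n A"
  obtains U d where "unitary n U" "\<And>i. i < n \<Longrightarrow> d i > 0"
    "\<And>i j. i \<le> j \<Longrightarrow> j < n \<Longrightarrow> d j \<le> d i" "A = U * rdiag n d * adj U"
  using hermitian_spectral_sorted[OF pos_def_hermitian[OF assms]] assms pos_def_diag_iff by metis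

lemma eigprod_pos:
  assumes "pos_def n A" "k \<le> n"
  shows "eigprod k A > 0"
proof -
  obtain U d where U: "unitary n U" "\<And>i. i < n \<Longrightarrow> d i > 0"
    "\<And>i j. i \<le> j \<Longrightarrow> j < n \<Longrightarrow> d j \<le> d i" "A = U * rdiag n d * adj U"
    using pos_def_spectral_sorted[OF assms(1)] by metis
  have "eigprod k A = (\<Prod>i<k. d i)"
    unfolding U(4) by (rule eigprod_diag[OF U(1,3) assms(2)])
  then show ?thesis using U(2) assms(2) by (auto intro!: prod_pos)
qed

text \<open>A nonnegative exponent preserves the order of the eigenvalues, so the sorted
  diagonalization of \<open>A\<close> is also sorted for its power.\<close>

lemma eigprod_mpow:
  assumes "pos_def n A" "k \<le> n" "r \<ge> 0"
  shows "eigprod k (mpow n A r) = eigprod k A powr r"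
proof -
  obtain U d where U: "unitary n U" "\<And>i. i < n \<Longrightarrow> d i > 0"
    "\<And>i j. i \<le> j \<Longrightarrow> j < n \<Longrightarrow> d j \<le> d i" "A = U * rdiag n d * adj U"
    using pos_def_spectral_sorted[OF assms(1)] by metis
  have *: "d j powr r \<le> d i powr r" if "i \<le> j" "j < n" for i j
    using U(2)[OF that(2)] U(3)[OF that] assms(3) by (intro powr_mono2) auto
  have "eigprod k (mpow n A r) = (\<Prod>i<k. d i powr r)"
    unfolding U(4) mpow_diag[OF U(1)] by (rule eigprod_diag[OF U(1) * assms(2)])
  also have "\<dots> = (\<Prod>i<k. d i) powr r"
    using U(2) assms(2) by (simp add: prod_powr_distrib less_imp_le)
  also have "(\<Prod>i<k. d i) = eigprod k A"
    unfolding U(4) using eigprod_diag[OF U(1,3) assms(2)] by simp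
  finally show ?thesis .
qed

text \<open>With \<open>det_compression_attained\<close> this is the variational description of the
  product of the \<open>k\<close> largest eigenvalues; it follows from the diagonal case by the
  substitution \<open>W = adj U * V\<close>.\<close>

lemma det_compression_le_eigprod:
  assumes "pos_def n A" "k \<le> n" and V: "V \<in> carrier_mat n k"
  shows "Re (det (adj V * (A * V))) \<le> eigprod k A * Re (det (adj V * V))"
proof -
  obtain U d where U: "unitary n U" "\<And>i. i < n \<Longrightarrow> d i > 0"
    "\<And>i j. i \<le> j \<Longrightarrow> j < n \<Longrightarrow> d j \<le> d i" "A = U * rdiag n d * adj U"
    using pos_def_spectral_sorted[OF assms(1)] by metis
  note [simp] = unitaryD[OF U(1)] carrier_matD[OF V]
  define W where "W = adj U * V"
  have Wc: "W \<in> carrier_mat n k" by (simp add: W_def carrier_matI)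
  have "Re (det (adj W * (rdiag n d * W))) \<le> (\<Prod>i<k. d i) * Re (det (adj W * W))"
    by (rule det_compression_le[OF Wc less_imp_le[OF U(2)] U(3)])
  moreover have "adj W * (rdiag n d * W) = adj V * (A * V)" "adj W * W = adj V * V"
    by (simp_all add: W_def U(4) mat_assoc)
  moreover have "eigprod k A = (\<Prod>i<k. d i)"
    unfolding U(4) by (rule eigprod_diag[OF U(1,3) assms(2)])
  ultimately show ?thesis by simp
qed

lemma det_compression_attained:
  assumes "pos_def n A" "k \<le> n"
  obtains V where "V \<in> carrier_mat n k" "Re (det (adj V * (A * V))) = eigprod k A" "adj V * V = 1\<^sub>m k"
proof -
  obtain U d where U: "unitary n U" "\<And>i. i < n \<Longrightarrow> d i > 0"
    "\<And>i j. i \<le> j \<Longrightarrow> j < n \<Longrightarrow> d j \<le> d i" "A = U * rdiag n d * adj U"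
    using pos_def_spectral_sorted[OF assms(1)] by metis
  note [simp] = unitaryD[OF U(1)]
  \<comment> \<open>Multiplication by \<open>E\<close> selects the first \<open>k\<close> columns of
    \<open>U\<close>, that is, eigenvectors for the \<open>k\<close> largest eigenvalues.\<close>
  define E where "E = mat n k (\<lambda>(i,j). if i = j then 1 else 0 :: complex)"
  define V where "V = U * E"
  have Ec: "E \<in> carrier_mat n k" and Ed [simp]: "dim_row E = n" "dim_col E = k" by (auto simp: E_def)
  have E_index: "E $$ (i, j) = (if i = j then 1 else 0)" if "i < n" "j < k" for i j
    using that by (simp add: E_def)
  have DE: "(rdiag n e * E) $$ (l, j) = (if l = j then complex_of_real (e l) else 0)" if "l < n" "j < k" for e l j
    unfolding rdiag_mult_index[OF Ec that] using that by (simp add: E_index)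
  have EDE: "adj E * (rdiag n e * E) = rdiag k e" for e
  proof (rule eq_matI)
    fix i j assume "i < dim_row (rdiag k e)" "j < dim_col (rdiag k e)"
    then have ij: "i < k" "j < k" by auto
    have "(adj E * (rdiag n e * E)) $$ (i,j) = (\<Sum>l = 0..<n. cnj (E $$ (l,i)) * (rdiag n e * E) $$ (l,j))"
      using ij by (subst index_mult_mat(1)) (auto simp: scalar_prod_def simp del: index_mult_mat(1))
    also have "\<dots> = (\<Sum>l = 0..<n. if l = i then (if i = j then complex_of_real (e i) else 0) else 0)"
      using ij assms(2) by (intro sum.cong) (auto simp: DE E_index simp del: index_mult_mat(1))
    finally show "(adj E * (rdiag n e * E)) $$ (i,j) = rdiag k e $$ (i,j)"
      using ij assms(2) by simp
  qed auto
  have "adj V * V = 1\<^sub>m k"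
    using EDE[of "\<lambda>_. 1"] by (simp add: V_def mat_assoc rdiag_one)
  moreover have "adj V * (A * V) = rdiag k d"
    using EDE[of d] by (simp add: V_def U(4) mat_assoc)
  moreover have "Re (det (rdiag k d)) = eigprod k A"
  proof -
    have "eigprod k A = (\<Prod>i<k. d i)"
      unfolding U(4) by (rule eigprod_diag[OF U(1,3) assms(2)])
    then show ?thesis by (simp add: det_rdiag flip: of_real_prod)
  qed
  ultimately show ?thesis using that[of V] by (simp add: V_def carrier_matI)
qed

section \<open>Products of the largest singular values\<close>

definition nonsing :: "nat \<Rightarrow> complex mat set" where
  "nonsing n = {X \<in> carrier_mat n n. det X \<noteq> 0}"

lemma nonsingD:
  assumes "X \<in> nonsing n"
  shows "X \<in> carrier_mat n n" "dim_row X = n" "dim_col X = n" "det X \<noteq> 0"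
  using assms by (auto simp: nonsing_def)

lemma nonsing_mult [simp]: "X \<in> nonsing n \<Longrightarrow> Y \<in> nonsing n \<Longrightarrow> X * Y \<in> nonsing n"
  by (auto simp: nonsing_def det_mult[of _ n] simp del: assoc_mult_mat)

lemma nonsing_adj [simp]: "X \<in> nonsing n \<Longrightarrow> adj X \<in> nonsing n"
  by (auto simp: nonsing_def det_adj[of _ n])

lemma nonsing_pos_def: "pos_def n A \<Longrightarrow> A \<in> nonsing n"
  using det_pos_def(2)[of n A] pos_def_carrier[of n A] by (auto simp: nonsing_def)

lemma nonsing_mpow [simp]: "pos_def n A \<Longrightarrow> mpow n A x \<in> nonsing n"
  by (intro nonsing_pos_def pos_def_mpow)

lemma nonsing_one [simp]: "1\<^sub>m n \<in> nonsing n"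
  by (simp add: nonsing_def)

lemma nonsing_inverse:
  assumes "X \<in> nonsing n"
  obtains Y where "Y \<in> carrier_mat n n" "Y * X = 1\<^sub>m n" "X * Y = 1\<^sub>m n"
  using det_non_zero_imp_unit[OF nonsingD(1,4)[OF assms], of undefined]
  by (auto simp: Units_def ring_mat_def)

lemma pos_def_one: "pos_def n (1\<^sub>m n)"
  using pos_def_rdiag_iff[of n "\<lambda>_. 1"] by (simp add: rdiag_one)

lemma pos_def_congr_nonsing:
  assumes "pos_def n A" "X \<in> nonsing n"
  shows "pos_def n (adj X * A * X)"
  using nonsing_inverse[OF assms(2)] pos_def_congruence[OF assms(1) nonsingD(1)[OF assms(2)]] by metis

lemma pos_def_adj_mult:
  assumes "X \<in> nonsing n"
  shows "pos_def n (adj X * X)"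
  using pos_def_congr_nonsing[OF pos_def_one assms] by (simp add: nonsingD[OF assms])

text \<open>This is the \<open>N\<close> of the overview: for \<open>k <= n\<close>, the squared
  operator norm of the \<open>k\<close>-th exterior power of \<open>X\<close>. Keeping the square
  avoids taking roots.\<close>

definition knorm :: "nat \<Rightarrow> complex mat \<Rightarrow> real" where
  "knorm k X = eigprod k (adj X * X)"

lemma knorm_pos: "X \<in> nonsing n \<Longrightarrow> k \<le> n \<Longrightarrow> knorm k X > 0"
  unfolding knorm_def by (intro eigprod_pos pos_def_adj_mult)

text \<open>A maximizer \<open>V\<close> for \<open>X * Y\<close> is used twice: the bound for
  \<open>X\<close> is applied to the test matrix \<open>Y * V\<close>, then the bound for
  \<open>Y\<close> to \<open>V\<close> itself.\<close>

lemma knorm_mult: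
  assumes X: "X \<in> nonsing n" and Y: "Y \<in> nonsing n" and k: "k \<le> n"
  shows "knorm k (X * Y) \<le> knorm k X * knorm k Y"
proof -
  note [simp] = nonsingD(2,3)[OF X] nonsingD(2,3)[OF Y]
  obtain V where V: "V \<in> carrier_mat n k"
    "Re (det (adj V * (adj (X * Y) * (X * Y) * V))) = eigprod k (adj (X * Y) * (X * Y))" "adj V * V = 1\<^sub>m k"
    using det_compression_attained[OF pos_def_adj_mult[OF nonsing_mult[OF X Y]] k] by metis
  note [simp] = carrier_matD[OF V(1)]
  have YV: "Y * V \<in> carrier_mat n k" by (simp add: carrier_matI)
  have "knorm k (X * Y) = Re (det (adj (Y * V) * (adj X * X * (Y * V))))"
    unfolding knorm_def V(2)[symmetric] by (simp add: mat_assoc)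
  also have "\<dots> \<le> knorm k X * Re (det (adj (Y * V) * (Y * V)))"
    unfolding knorm_def by (rule det_compression_le_eigprod[OF pos_def_adj_mult[OF X] k YV])
  also have "adj (Y * V) * (Y * V) = adj V * (adj Y * Y * V)"
    by (simp add: mat_assoc)
  also have "Re (det (adj V * (adj Y * Y * V))) \<le> knorm k Y * Re (det (adj V * V))"
    unfolding knorm_def by (rule det_compression_le_eigprod[OF pos_def_adj_mult[OF Y] k V(1)])
  finally show ?thesis using knorm_pos[OF X k] V(3) by (simp add: mult_left_mono)
qed

text \<open>For invertible \<open>X\<close> the two Gram matrices are similar via \<open>X\<close>,
  and \<open>eigs\<close> depends on the characteristic polynomial alone.\<close>

lemma knorm_adj:
  assumes X: "X \<in> nonsing n"
  shows "knorm k (adj X) = knorm k X"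
proof -
  note [simp] = nonsingD(2,3)[OF X]
  obtain Y where Y: "Y \<in> carrier_mat n n" "Y * X = 1\<^sub>m n" "X * Y = 1\<^sub>m n"
    using nonsing_inverse[OF X] by metis
  note [simp] = carrier_matD[OF Y(1)]
  have "similar_mat_wit (X * adj X) (adj X * X) X Y"
    by (rule similar_mat_witI[of _ _ n])
       (use X Y in \<open>auto simp: mat_assoc nonsingD(1) simp del: assoc_mult_mat\<close>)
  then have "char_poly (X * adj X) = char_poly (adj X * X)"
    by (intro char_poly_similar) (auto simp: similar_mat_def)
  then show ?thesis by (simp add: knorm_def eigprod_def eig_def eigs_def)
qed

lemma knorm_pos_def:
  assumes "pos_def n A" "k \<le> n"
  shows "knorm k A = (eigprod k A)\<^sup>2"
proof -
  have "adj A * A = mpow n A 2"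
    using pos_def_hermitian[OF assms(1)] mpow_add[OF assms(1), of 1 1]
    by (simp add: hermitian_def mpow_1[OF assms(1)])
  then show ?thesis
    using eigprod_mpow[OF assms, of 2] eigprod_pos[OF assms] by (simp add: knorm_def)
qed

lemma knorm_adj_mult: "X \<in> nonsing n \<Longrightarrow> k \<le> n \<Longrightarrow> knorm k (adj X * X) = (knorm k X)\<^sup>2"
  using knorm_pos_def[OF pos_def_adj_mult] by (simp add: knorm_def)

lemma knorm_one:
  assumes "k \<le> n"
  shows "knorm k (1\<^sub>m n) = 1"
  using eigprod_mpow[OF pos_def_one assms, of 0] eigprod_pos[OF pos_def_one assms]
  by (simp add: knorm_def mpow_0[OF pos_def_one])

section \<open>Matrix powers and the swap inequality\<close>

lemma nonsing_pow_mat: "X \<in> nonsing n \<Longrightarrow> X ^\<^sub>m m \<in> nonsing n"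
  by (induction m) (auto simp: nonsingD)

lemma knorm_pow_mat:
  assumes X: "X \<in> nonsing n" and k: "k \<le> n"
  shows "knorm k (X ^\<^sub>m m) \<le> knorm k X ^ m"
proof (induction m)
  case 0
  then show ?case using knorm_one[OF k] by (simp add: nonsingD[OF X])
next
  case (Suc m)
  have "knorm k (X ^\<^sub>m Suc m) \<le> knorm k (X ^\<^sub>m m) * knorm k X"
    using knorm_mult[OF nonsing_pow_mat[OF X] X k] by simp
  also have "\<dots> \<le> knorm k X ^ m * knorm k X"
    using Suc knorm_pos[OF X k] by (simp add: mult_right_mono)
  finally show ?case by (simp add: mult.commute)
qed

lemma pow_mat_add:
  fixes X :: "complex mat"
  assumes "X \<in> carrier_mat n n"
  shows "X ^\<^sub>m (m + m') = X ^\<^sub>m m * X ^\<^sub>m m'"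
proof (induction m')
  case (Suc m')
  then show ?case using assms by (simp add: mat_assoc carrier_matD[OF assms] pow_mat_dim)
qed (use assms in \<open>simp add: pow_mat_dim\<close>)

lemma adj_pow_mat:
  assumes X: "X \<in> carrier_mat n n" and "adj X = X"
  shows "adj (X ^\<^sub>m m) = X ^\<^sub>m m"
proof (induction m)
  case (Suc m)
  have "adj (X ^\<^sub>m Suc m) = X * X ^\<^sub>m m"
    using Suc assms by (simp add: carrier_matD[OF X] pow_mat_dim)
  also have "\<dots> = X ^\<^sub>m (1 + m)" unfolding pow_mat_add[OF X] using X by simp
  finally show ?case by simp
qed (use assms in simp)

text \<open>For Hermitian \<open>Y\<close> the square is \<open>adj Y * Y\<close>, so
  \<open>knorm_adj_mult\<close> gives equality under squaring; iterating it reaches the exponents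
  \<open>2 ^ m\<close>.\<close>

lemma knorm_hermitian_pow2:
  assumes X: "X \<in> nonsing n" "adj X = X" and k: "k \<le> n"
  shows "knorm k (X ^\<^sub>m (2 ^ m)) = knorm k X ^ (2 ^ m)"
proof (induction m)
  case 0
  then show ?case using nonsingD[OF X(1)] by (simp)
next
  case (Suc m)
  let ?Y = "X ^\<^sub>m (2 ^ m)"
  have "adj ?Y = ?Y" by (rule adj_pow_mat[OF nonsingD(1)[OF X(1)] X(2)])
  then have "knorm k (?Y * ?Y) = (knorm k ?Y)\<^sup>2"
    using knorm_adj_mult[OF nonsing_pow_mat[OF X(1)] k, of "2 ^ m"] by simp
  moreover have "?Y * ?Y = X ^\<^sub>m (2 ^ Suc m)"
    using pow_mat_add[OF nonsingD(1)[OF X(1)], of "2 ^ m" "2 ^ m"] by (simp add: mult_2)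
  ultimately show ?case using Suc by (simp add: power2_eq_square mult_2 power_add)
qed

text \<open>A constant factor independent of \<open>m\<close> is absorbed by high powers: if
  \<open>a / b\<close> exceeded 1, its powers would outgrow \<open>c\<close>.\<close>

lemma le_of_pow2_bound:
  fixes a b c :: real
  assumes "0 < a" "0 < b" "\<And>m. a ^ (2 ^ m) \<le> c * b ^ (2 ^ m)"
  shows "a \<le> b"
proof (rule ccontr)
  assume "\<not> a \<le> b"
  then have "1 < a / b" using assms by simp
  then obtain N where N: "c < (a / b) ^ N" using real_arch_pow by blast
  have "N \<le> 2 ^ N" by (simp add: less_imp_le)
  then have "(a / b) ^ N \<le> (a / b) ^ (2 ^ N)" using \<open>1 < a / b\<close> by (intro power_increasing) auto
  then have "c < a ^ (2 ^ N) / b ^ (2 ^ N)" using N by (simp add: power_divide)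
  then have "c * b ^ (2 ^ N) < a ^ (2 ^ N)" using assms(2) by (simp add: pos_less_divide_eq)
  then show False using assms(3)[of N] by simp
qed

text \<open>Since \<open>(XY)\<^bsup>l+1\<^esup> = X (YX)\<^bsup>l\<^esup> Y\<close>, comparing the growth of the two sides gives the claim.\<close>

lemma knorm_mult_swap:
  assumes X: "X \<in> nonsing n" and Y: "Y \<in> nonsing n" and XY: "adj (X * Y) = X * Y" and k: "k \<le> n"
  shows "knorm k (X * Y) \<le> knorm k (Y * X)"
proof (rule le_of_pow2_bound)
  note [simp] = nonsingD(2,3)[OF X] nonsingD(2,3)[OF Y]
  show "0 < knorm k (X * Y)" by (rule knorm_pos[OF nonsing_mult[OF X Y] k])
  show nYX: "0 < knorm k (Y * X)" by (rule knorm_pos[OF nonsing_mult[OF Y X] k])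
  fix m
  have nX: "knorm k X > 0" and nY: "knorm k Y > 0" using knorm_pos[OF X k] knorm_pos[OF Y k] by auto
  have shift: "(X * Y) ^\<^sub>m Suc l = X * (Y * X) ^\<^sub>m l * Y" for l
  proof (induction l)
    case (Suc l)
    have "dim_row ((Y * X) ^\<^sub>m l) = n" "dim_col ((Y * X) ^\<^sub>m l) = n"
      using nonsingD[OF nonsing_pow_mat[OF nonsing_mult[OF Y X]]] by auto
    then show ?case using Suc by (simp add: mat_assoc)
  qed simp
  obtain l where l: "2 ^ m = Suc l" by (metis Suc_pred' pos2 zero_less_power)
  have "knorm k (X * Y) ^ (2 ^ m) = knorm k ((X * Y) ^\<^sub>m (2 ^ m))"
    using knorm_hermitian_pow2[OF nonsing_mult[OF X Y] XY k] by simp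
  also have "\<dots> = knorm k (X * (Y * X) ^\<^sub>m l * Y)" unfolding l shift ..
  also have "\<dots> \<le> knorm k (X * (Y * X) ^\<^sub>m l) * knorm k Y"
    using X Y k by (intro knorm_mult nonsing_mult nonsing_pow_mat)
  also have "\<dots> \<le> knorm k X * knorm k ((Y * X) ^\<^sub>m l) * knorm k Y"
    using X Y k nY by (intro mult_right_mono knorm_mult nonsing_pow_mat nonsing_mult) auto
  also have "\<dots> \<le> knorm k X * knorm k (Y * X) ^ l * knorm k Y"
    using X Y k nX nY by (intro mult_right_mono mult_left_mono knorm_pow_mat nonsing_mult) auto
  \<comment> \<open>Dividing by one factor \<open>knorm k (Y * X)\<close> restores the exponent
    \<open>2 ^ m\<close> and leaves a constant that does not depend on \<open>m\<close>.\<close>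
  also have "\<dots> = knorm k X * knorm k Y / knorm k (Y * X) * knorm k (Y * X) ^ (2 ^ m)"
    unfolding l using nYX by simp
  finally show "knorm k (X * Y) ^ (2 ^ m) \<le> knorm k X * knorm k Y / knorm k (Y * X) * knorm k (Y * X) ^ (2 ^ m)" .
qed

section \<open>Log-convexity of \<open>knorm (Q\<^sup>x S R\<^sup>x)\<close>\<close>

text \<open>Every point of the interval is the midpoint of one endpoint and another point of the interval,
  so the supremum \<open>M\<close> of \<open>f\<close> satisfies \<open>M \<le> M / 2\<close>.\<close>

lemma midpoint_convex_nonpos:
  fixes f :: "real \<Rightarrow> real"
  assumes mid: "\<And>x y. x \<in> {a..b} \<Longrightarrow> y \<in> {a..b} \<Longrightarrow> f ((x + y) / 2) \<le> (f x + f y) / 2"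
    and bdd: "\<And>x. x \<in> {a..b} \<Longrightarrow> f x \<le> K" and "f a \<le> 0" "f b \<le> 0" and x: "x \<in> {a..b}"
  shows "f x \<le> 0"
proof -
  let ?M = "Sup (f ` {a..b})"
  have ab: "a \<in> {a..b}" "b \<in> {a..b}" using x by auto
  have bdd': "bdd_above (f ` {a..b})" using bdd by (intro bdd_aboveI2[of _ _ K])
  have M: "f z \<le> ?M" if "z \<in> {a..b}" for z using that bdd' by (auto intro: cSup_upper)
  have half: "f z \<le> ?M / 2" if z: "z \<in> {a..b}" for z
  proof (cases "2 * z \<le> a + b")
    case True
    then have y: "2 * z - a \<in> {a..b}" using z by auto
    show ?thesis using mid[OF ab(1) y] M[OF y] assms(3) by simp
  next
    case False
    then have y: "2 * z - b \<in> {a..b}" using z by auto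
    show ?thesis using mid[OF ab(2) y] M[OF y] assms(4) by simp
  qed
  have "?M \<le> ?M / 2" using ab half by (intro cSup_least) auto
  then show ?thesis using M[OF x] by simp
qed

lemma adj_mpow [simp]: "pos_def n A \<Longrightarrow> adj (mpow n A x) = mpow n A x"
  using pos_def_hermitian[OF pos_def_mpow] by (auto simp: hermitian_def)

lemma dim_mpow [simp]:
  assumes "pos_def n A"
  shows "dim_row (mpow n A x) = n" "dim_col (mpow n A x) = n"
  using nonsingD(2,3)[OF nonsing_mpow[OF assms]] by auto

lemma mpow_add_left:
  assumes "pos_def n A" "dim_row X = n"
  shows "mpow n A x * (mpow n A y * X) = mpow n A (x + y) * X"
  using assms by (simp add: mpow_add flip: mat_assoc)

text \<open>Supplies the upper bound needed by \<open>midpoint_convex_nonpos\<close>. Splitting off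
  the power at \<open>a\<close> leaves the nonnegative exponent \<open>x - a\<close>, to which
  \<open>eigprod_mpow\<close> applies; the maximum with 1 makes the bound monotone in that
  exponent.\<close>

lemma knorm_mpow_bounded:
  assumes A: "pos_def n A" and k: "k \<le> n"
  obtains K where "K > 0" "\<And>x. x \<in> {a..b} \<Longrightarrow> knorm k (mpow n A x) \<le> K"
proof -
  define K where "K = knorm k (mpow n A a) * ((max 1 (eigprod k A) powr (b - a))\<^sup>2)"
  have pos: "knorm k (mpow n A a) > 0" by (rule knorm_pos[OF nonsing_mpow[OF A] k])
  have "knorm k (mpow n A x) \<le> K" if x: "x \<in> {a..b}" for x
  proof -
    have "knorm k (mpow n A x) = knorm k (mpow n A a * mpow n A (x - a))"
      using A by (simp add: mpow_add)
    also have "\<dots> \<le> knorm k (mpow n A a) * knorm k (mpow n A (x - a))"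
      using A k by (intro knorm_mult) auto
    also have "knorm k (mpow n A (x - a)) = (eigprod k A powr (x - a))\<^sup>2"
      using x by (simp add: knorm_pos_def[OF pos_def_mpow[OF A] k] eigprod_mpow[OF A k])
    also have "knorm k (mpow n A a) * (eigprod k A powr (x - a))\<^sup>2 \<le> K"
    proof -
      have "eigprod k A powr (x - a) \<le> max 1 (eigprod k A) powr (x - a)"
        using eigprod_pos[OF A k] x by (intro powr_mono2) auto
      also have "\<dots> \<le> max 1 (eigprod k A) powr (b - a)"
        using x by (intro powr_mono) auto
      finally show ?thesis unfolding K_def using pos by (intro mult_left_mono power_mono) auto
    qed
    finally show ?thesis .
  qed
  moreover have "K > 0" using pos by (simp add: K_def)
  ultimately show ?thesis using that by blast
qed

text \<open>With \<open>m = (x + y) / 2\<close>, the Gram matrix of \<open>F m\<close> has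
  \<open>Q\<close> to the power \<open>x + y\<close> in its middle. Moving a factor \<open>R\<close>
  to the power \<open>(y - x) / 2\<close> from its left end to its right end turns it into
  \<open>adj (F x) * F y\<close>, and \<open>knorm_mult_swap\<close> compares the two.\<close>

lemma knorm_mpow_midpoint:
  assumes Q: "pos_def n Q" and R: "pos_def n R" and S: "S \<in> nonsing n" and k: "k \<le> n"
  defines "F \<equiv> \<lambda>x. mpow n Q x * S * mpow n R x"
  shows "(knorm k (F ((x + y) / 2)))\<^sup>2 \<le> knorm k (F x) * knorm k (F y)"
proof -
  note [simp] = nonsingD(2,3)[OF S] dim_mpow[OF Q] dim_mpow[OF R] adj_mpow[OF Q] adj_mpow[OF R]
  have F: "F x \<in> nonsing n" for x using Q R S by (simp add: F_def)
  let ?m = "(x + y) / 2" and ?e = "(y - x) / 2"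
  define X where "X = mpow n R ?e"
  define Y where "Y = mpow n R x * adj S * mpow n Q (x + y) * S * mpow n R ?m"
  have XY: "X \<in> nonsing n" "Y \<in> nonsing n" using Q R S by (simp_all add: X_def Y_def)
  have e: "?e + x = ?m" "?m + ?e = y" by (auto simp: field_simps)
  have 1: "X * Y = adj (F ?m) * F ?m"
    by (simp add: X_def Y_def F_def mat_assoc mpow_add_left[OF R] mpow_add_left[OF Q] e)
  have 2: "Y * X = adj (F x) * F y"
    by (simp add: X_def Y_def F_def mat_assoc mpow_add[OF R] mpow_add_left[OF Q] e)
  have d: "dim_row (F z) = n" "dim_col (F z) = n" for z using nonsingD[OF F] by auto
  have "(knorm k (F ?m))\<^sup>2 = knorm k (X * Y)"
    unfolding 1 using knorm_adj_mult[OF F k] by simp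
  also have "\<dots> \<le> knorm k (Y * X)"
    by (rule knorm_mult_swap[OF XY _ k]) (simp add: 1 d)
  also have "\<dots> \<le> knorm k (adj (F x)) * knorm k (F y)"
    unfolding 2 by (rule knorm_mult[OF nonsing_adj[OF F] F k])
  also have "\<dots> = knorm k (F x) * knorm k (F y)"
    by (simp add: knorm_adj[OF F])
  finally show ?thesis .
qed

text \<open>Convexity in the form used later: an affine bound at both endpoints holds in between.
  Subtracting the affine function leaves a midpoint convex function that is bounded above and
  nonpositive at the ends.\<close>

lemma knorm_three_lines:
  assumes Q: "pos_def n Q" and R: "pos_def n R" and S: "S \<in> nonsing n" and k: "k \<le> n"
  defines "F \<equiv> \<lambda>x. mpow n Q x * S * mpow n R x"
  assumes a: "ln (knorm k (F a)) \<le> m * a + c" and b: "ln (knorm k (F b)) \<le> m * b + c" and x: "x \<in> {a..b}"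
  shows "ln (knorm k (F x)) \<le> m * x + c"
proof -
  have F: "F z \<in> nonsing n" for z using Q R S by (simp add: F_def)
  have pos: "knorm k (F z) > 0" for z by (rule knorm_pos[OF F k])
  obtain K1 where K1: "K1 > 0" "\<And>x. x \<in> {a..b} \<Longrightarrow> knorm k (mpow n Q x) \<le> K1"
    using knorm_mpow_bounded[OF Q k] by metis
  obtain K2 where K2: "K2 > 0" "\<And>x. x \<in> {a..b} \<Longrightarrow> knorm k (mpow n R x) \<le> K2"
    using knorm_mpow_bounded[OF R k] by metis
  define f where "f z = ln (knorm k (F z)) - (m * z + c)" for z
  have "f x \<le> 0"
  proof (rule midpoint_convex_nonpos[where f = f and a = a and b = b])
    fix x y
    have "2 * ln (knorm k (F ((x + y) / 2))) = ln ((knorm k (F ((x + y) / 2)))\<^sup>2)"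
      using pos by (simp add: ln_realpow)
    also have "\<dots> \<le> ln (knorm k (F x) * knorm k (F y))"
      using knorm_mpow_midpoint[OF Q R S k, of x y] pos[of x] pos[of y] pos[of "(x + y) / 2"]
      by (subst ln_le_cancel_iff) (auto simp: F_def)
    also have "\<dots> = ln (knorm k (F x)) + ln (knorm k (F y))"
      using pos[of x] pos[of y] by (simp add: ln_mult)
    finally show "f ((x + y) / 2) \<le> (f x + f y) / 2"
      by (simp add: f_def field_simps)
  next
    fix z assume z: "z \<in> {a..b}"
    have "knorm k (F z) \<le> knorm k (mpow n Q z * S) * knorm k (mpow n R z)"
      unfolding F_def using Q R S k by (intro knorm_mult) auto
    also have "\<dots> \<le> knorm k (mpow n Q z) * knorm k S * knorm k (mpow n R z)"
      using Q S k knorm_pos[OF nonsing_mpow[OF R] k, of z] by (intro mult_right_mono knorm_mult) auto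
    also have "\<dots> \<le> K1 * knorm k S * K2"
      using K1 K2 z knorm_pos[OF S k] knorm_pos[OF nonsing_mpow[OF R] k, of z]
      by (intro mult_mono) auto
    finally have "ln (knorm k (F z)) \<le> ln (K1 * knorm k S * K2)"
      using pos K1 K2 knorm_pos[OF S k] by (subst ln_le_cancel_iff) auto
    moreover have "\<bar>m * z\<bar> \<le> \<bar>m\<bar> * (\<bar>a\<bar> + \<bar>b\<bar>)"
      unfolding abs_mult using z by (intro mult_left_mono) auto
    ultimately show "f z \<le> ln (K1 * knorm k S * K2) + \<bar>m\<bar> * (\<bar>a\<bar> + \<bar>b\<bar>) + \<bar>c\<bar>"
      by (simp add: f_def)
  qed (use a b x in \<open>auto simp: f_def\<close>)
  then show ?thesis by (simp add: f_def)
qed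

section \<open>The log-majorization\<close>

text \<open>A Cordes-type inequality: the interval is \<open>{0..1}\<close> with \<open>S\<close>
  the identity, and at 0 the logarithm vanishes, so the bounding line passes through the
  origin.\<close>

lemma knorm_cordes:
  assumes Q: "pos_def n Q" and R: "pos_def n R" and k: "k \<le> n" and x: "0 \<le> x" "x \<le> 1"
  shows "ln (knorm k (mpow n Q x * mpow n R x)) \<le> x * ln (knorm k (Q * R))"
  using knorm_three_lines[OF Q R nonsing_one k, of 0 "ln (knorm k (Q * R))" 0 1 x] x knorm_one[OF k]
  by (simp add: mpow_0[OF Q] mpow_0[OF R] mpow_1[OF Q] mpow_1[OF R] dim_mpow[OF Q] carrier_matD[OF pos_def_carrier[OF Q]] mult.commute)

text \<open>The geometric mean of the inverse of \<open>A\<close> with \<open>B\<close> is a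
  positive definite solution of the Riccati equation \<open>G * A * G = B\<close>. It is the square
  root of \<open>T\<close>, conjugated by \<open>A\<close> to the power \<open>-1/2\<close>.\<close>

lemma pos_def_gmean_inverse:
  assumes A: "pos_def n A" and B: "pos_def n B"
  defines "G \<equiv> gmean n (mpow n A (-1)) B"
  shows "pos_def n G" "G * A * G = B"
proof -
  note [simp] = dim_mpow[OF A] carrier_matD[OF pos_def_carrier[OF B]]
  define T where "T = mpow n A (1/2) * B * mpow n A (1/2)"
  have T: "pos_def n T"
    using pos_def_congr_nonsing[OF B nonsing_mpow[OF A, of "1/2"]] by (simp add: T_def adj_mpow[OF A])
  note [simp] = dim_mpow[OF T]
  have G: "G = mpow n A (-1/2) * mpow n T (1/2) * mpow n A (-1/2)"
    by (simp add: G_def gmean_def mpow_mpow[OF A] T_def)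
  show "pos_def n G"
    using pos_def_congr_nonsing[OF pos_def_mpow[OF T] nonsing_mpow[OF A, of "-1/2"]]
    by (simp add: G adj_mpow[OF A])
  have "G * A * G = G * mpow n A 1 * G" by (simp add: mpow_1[OF A])
  also have "\<dots> = mpow n A (-1/2) * (mpow n T 1 * mpow n A (-1/2))"
    by (simp add: G mat_assoc mpow_add_left[OF A] mpow_add_left[OF T] mpow_0[OF A])
  also have "\<dots> = B"
    by (simp add: mpow_1[OF T], simp add: T_def mat_assoc mpow_add_left[OF A] mpow_add[OF A] mpow_0[OF A])
  finally show "G * A * G = B" .
qed

text \<open>Inverts the Riccati equation, so that the inverse of \<open>B\<close> can be traded for
  powers of \<open>G\<close> and \<open>A\<close>; the candidate \<open>?C\<close> is checked to be
  a left inverse of \<open>B\<close>.\<close>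

lemma mpow_inverse_congruence:
  assumes A: "pos_def n A" and B: "pos_def n B" and G: "pos_def n G" and GAG: "G * A * G = B"
  shows "mpow n B (-1) = mpow n G (-1) * mpow n A (-1) * mpow n G (-1)"
proof -
  note [simp] = dim_mpow[OF A] dim_mpow[OF B] dim_mpow[OF G]
  let ?C = "mpow n G (-1) * mpow n A (-1) * mpow n G (-1)"
  have "?C * mpow n B 1 = ?C * (mpow n G 1 * mpow n A 1 * mpow n G 1)"
    by (simp add: mpow_1[OF A] mpow_1[OF B] mpow_1[OF G] GAG)
  also have "\<dots> = 1\<^sub>m n"
    by (simp add: mat_assoc mpow_add_left[OF A] mpow_add_left[OF G] mpow_add[OF G] mpow_0[OF A] mpow_0[OF G])
  finally have "?C * mpow n B 1 * mpow n B (-1) = mpow n B (-1)" by simp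
  then show ?thesis by (simp add: mat_assoc mpow_add[OF B] mpow_0[OF B])
qed

lemma eigprod_spt_le:
  assumes A: "pos_def n A" and B: "pos_def n B" and t: "-1 \<le> t" "t \<le> -1/2" and k: "k \<le> n"
  shows "eigprod k (spt n A t B)
    \<le> eigprod k (mpow n (mpow n A (1 - t) * mpow n B (2*t) * mpow n A (1 - t)) (1/2))"
proof -
  define s where "s = - t"
  have s: "1/2 \<le> s" "s \<le> 1" "s > 0" using t by (auto simp: s_def)
  define G where "G = gmean n (mpow n A (-1)) B"
  have G: "pos_def n G" and GAG: "G * A * G = B"
    unfolding G_def by (rule pos_def_gmean_inverse[OF A B])+
  define H where "H = mpow n G (-1)"
  have H: "pos_def n H" using G by (simp add: H_def)
  \<comment> \<open>The exponent is chosen so that \<open>R\<close> to the power \<open>s\<close> is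
    the square root of \<open>A\<close>; \<open>Q\<close> is the inverse of
    \<open>R\<close>.\<close>
  define R where "R = mpow n A (1/(2*s))"
  define Q where "Q = mpow n A (-1/(2*s))"
  have R: "pos_def n R" and Q: "pos_def n Q" using A by (simp_all add: R_def Q_def)
  note [simp] = dim_mpow[OF A] dim_mpow[OF B] dim_mpow[OF G] adj_mpow[OF A] adj_mpow[OF B] adj_mpow[OF G]
    nonsing_mpow[OF A] nonsing_mpow[OF B] nonsing_mpow[OF G]
  define w where "w = (1 + s) / (2 * s)"
  let ?N = "knorm k"
  let ?rhs = "mpow n B (- s) * mpow n A (1 + s)"

  \<comment> \<open>This is where \<open>t <= -1/2\<close> enters.\<close>
  have "1 / (2 * s) \<le> 1" using s by simp
  then have "ln (?N (mpow n (mpow n B (- s)) (1/(2*s)) * mpow n (mpow n A (1 + s)) (1/(2*s))))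
      \<le> 1 / (2 * s) * ln (?N ?rhs)"
    using s by (intro knorm_cordes pos_def_mpow A B k) auto
  moreover have "mpow n (mpow n B (- s)) (1/(2*s)) = mpow n B (- 1/2)"
    "mpow n (mpow n A (1 + s)) (1/(2*s)) = mpow n A w"
    using s by (simp_all add: mpow_mpow[OF A] mpow_mpow[OF B] w_def)
  ultimately have step1: "ln (?N (mpow n B (-1/2) * mpow n A w)) \<le> 1 / (2 * s) * ln (?N ?rhs)" by simp

  \<comment> \<open>\<open>L\<close> replaces the product of powers of \<open>B\<close> and
    \<open>A\<close> from \<open>step1\<close>: both have the same Gram matrix, because the inverse
    of \<open>B\<close> is \<open>H\<close> times the inverse of \<open>A\<close> times
    \<open>H\<close>.\<close>
  define L where "L = mpow n A (-1/2) * H * mpow n A w"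
  have L: "L \<in> nonsing n" by (simp add: L_def H_def)
  have "adj (mpow n B (-1/2) * mpow n A w) * (mpow n B (-1/2) * mpow n A w) = mpow n A w * mpow n B (-1) * mpow n A w"
    by (simp add: mat_assoc mpow_add_left[OF B])
  also have "\<dots> = adj L * L"
    by (simp add: mpow_inverse_congruence[OF A B G GAG] L_def H_def mat_assoc mpow_add_left[OF A])
  finally have step2: "?N (mpow n B (-1/2) * mpow n A w) = ?N L" by (simp add: knorm_def)

  \<comment> \<open>The values of \<open>F\<close> at \<open>s\<close> and \<open>-1 - s\<close> are
    \<open>L\<close> and \<open>adj L\<close>, which have equal \<open>knorm\<close>. Since 0 lies
    between these points, the constant bound \<open>ln (?N L)\<close> carries over to
    \<open>F 0 = H * R\<close>.\<close>
  define F where "F x = mpow n Q x * (H * R) * mpow n R x" for x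
  have F: "F x = mpow n A (- x / (2 * s)) * H * mpow n A ((1 + x) / (2 * s))" for x
    by (simp add: F_def Q_def R_def H_def mpow_mpow[OF A] mat_assoc mpow_add[OF A] add_divide_distrib)
  have Fs: "F s = L" using s by (simp add: F L_def w_def)
  have Fs': "F (- 1 - s) = adj L"
    using s by (simp add: F L_def w_def H_def mat_assoc add.commute)
  have "ln (?N (F 0)) \<le> 0 * 0 + ln (?N L)"
    unfolding F_def
    by (rule knorm_three_lines[OF Q R _ k, where a = "-1 - s" and b = s])
      (use s H R in \<open>simp_all add: nonsing_pos_def knorm_adj[OF L] Fs[unfolded F_def] Fs'[unfolded F_def]\<close>)
  moreover have "F 0 = H * R" by (simp add: F mpow_0[OF A] R_def H_def)
  ultimately have step3: "ln (?N (H * R)) \<le> ln (?N L)" by simp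

  \<comment> \<open>Here \<open>s <= 1\<close>, that is \<open>-1 <= t\<close>, is used.\<close>
  have "ln (?N (mpow n H s * mpow n R s)) \<le> s * ln (?N (H * R))"
    using s by (intro knorm_cordes H R k) auto
  moreover have "mpow n H s * mpow n R s = mpow n G t * mpow n A (1/2)"
    using s by (simp add: H_def R_def mpow_mpow[OF A] mpow_mpow[OF G]) (simp add: s_def)
  ultimately have step4: "ln (?N (mpow n G t * mpow n A (1/2))) \<le> s * ln (?N (H * R))" by simp

  have "ln (?N (mpow n G t * mpow n A (1/2))) \<le> s * ln (?N L)"
    using step4 mult_left_mono[OF step3, of s] s by linarith
  also have "\<dots> \<le> s * (1 / (2 * s) * ln (?N ?rhs))"
    using mult_left_mono[OF step1, of s] s unfolding step2 by simp
  also have "\<dots> = 1/2 * ln (?N ?rhs)" using s by simp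
  finally have main: "ln (?N (mpow n G t * mpow n A (1/2))) \<le> 1/2 * ln (?N ?rhs)" .

  have Z: "mpow n G t * mpow n A (1/2) \<in> nonsing n" and Z': "?rhs \<in> nonsing n" by simp_all
  have "spt n A t B = mpow n G t * mpow n A 1 * mpow n G t"
    by (simp add: spt_def mpow_1[OF A] G_def)
  \<comment> \<open>\<open>spt\<close> has the form \<open>Z * adj Z\<close>; writing it as the Gram
    matrix of \<open>adj Z\<close> lets \<open>knorm_adj\<close> return to \<open>Z\<close>.\<close>
  also have "\<dots> = adj (adj (mpow n G t * mpow n A (1/2))) * adj (mpow n G t * mpow n A (1/2))"
    by (simp add: mat_assoc mpow_add_left[OF A])
  finally have lhs: "eigprod k (spt n A t B) = ?N (mpow n G t * mpow n A (1/2))"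
    using knorm_adj[OF Z, of k] by (simp only: knorm_def)
  have "mpow n A (1 - t) * mpow n B (2*t) * mpow n A (1 - t) = adj ?rhs * ?rhs"
    by (simp add: s_def mat_assoc mpow_add_left[OF B])
  then have rhs: "eigprod k (mpow n (mpow n A (1 - t) * mpow n B (2*t) * mpow n A (1 - t)) (1/2)) = ?N ?rhs powr (1/2)"
    using eigprod_mpow[OF pos_def_adj_mult[OF Z'] k, of "1/2"] by (simp add: knorm_def)
  have "ln (?N (mpow n G t * mpow n A (1/2))) \<le> ln (?N ?rhs powr (1/2))"
    using main by (simp add: ln_powr)
  then have "?N (mpow n G t * mpow n A (1/2)) \<le> ?N ?rhs powr (1/2)"
    by (rule iffD1[OF ln_le_cancel_iff, rotated 2]) (use knorm_pos[OF Z k] knorm_pos[OF Z' k] in auto)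
  then show ?thesis unfolding lhs rhs .
qed

text \<open>The Riccati equation gives \<open>ln b = 2 * ln g + ln a\<close> for the determinants,
  and with it the logarithms of both sides equal \<open>t * ln b + (1 - t) * ln a\<close>.\<close>

lemma det_spt:
  assumes A: "pos_def n A" and B: "pos_def n B"
  shows "det (spt n A t B) = det (mpow n (mpow n A (1 - t) * mpow n B (2*t) * mpow n A (1 - t)) (1/2))"
proof -
  define G where "G = gmean n (mpow n A (-1)) B"
  have G: "pos_def n G" and GAG: "G * A * G = B"
    unfolding G_def by (rule pos_def_gmean_inverse[OF A B])+
  define a b g where "a = Re (det A)" and "b = Re (det B)" and "g = Re (det G)"
  have pos: "a > 0" "b > 0" "g > 0" using det_pos_def(2) A B G by (auto simp: a_def b_def g_def)
  note c = pos_def_carrier[OF A] pos_def_carrier[OF B] pos_def_carrier[OF G]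
    pos_def_carrier[OF pos_def_mpow[OF A]] pos_def_carrier[OF pos_def_mpow[OF B]] pos_def_carrier[OF pos_def_mpow[OF G]]
  have dets: "det A = of_real a" "det B = of_real b" "det G = of_real g"
    using det_pos_def(1) A B G by (auto simp: a_def b_def g_def)
  have "det B = det G * det A * det G"
    unfolding GAG[symmetric] using c by (simp add: det_mult[of _ n] del: assoc_mult_mat)
  then have "b = g * a * g" by (simp add: dets flip: of_real_mult)
  then have lnb: "ln b = 2 * ln g + ln a" using pos by (simp add: ln_mult)
  let ?Y = "mpow n A (1 - t) * mpow n B (2*t) * mpow n A (1 - t)"
  have Y: "pos_def n ?Y"
    using pos_def_congr_nonsing[OF pos_def_mpow[OF B] nonsing_mpow[OF A]] by (simp add: adj_mpow[OF A])
  have "det ?Y = of_real (a powr (1 - t) * b powr (2 * t) * a powr (1 - t))"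
    using c by (simp add: det_mult[of _ n] det_pos_def(3)[OF A, folded a_def] det_pos_def(3)[OF B, folded b_def] del: assoc_mult_mat)
  then have rhs: "det (mpow n ?Y (1/2)) = of_real ((a powr (1 - t) * b powr (2 * t) * a powr (1 - t)) powr (1/2))"
    using det_pos_def(3)[OF Y, of "1/2"] by simp
  have lhs: "det (spt n A t B) = of_real (g powr t * a * g powr t)"
    unfolding spt_def G_def[symmetric]
    using c by (simp add: det_mult[of _ n] det_pos_def(3)[OF G, folded g_def] dets del: assoc_mult_mat)
  have "ln (g powr t * a * g powr t) = ln ((a powr (1 - t) * b powr (2 * t) * a powr (1 - t)) powr (1/2))"
    using pos by (simp add: ln_mult ln_powr lnb) (simp add: field_simps)
  then have "g powr t * a * g powr t = (a powr (1 - t) * b powr (2 * t) * a powr (1 - t)) powr (1/2)"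
    by (rule iffD1[OF ln_inj_iff, rotated 2]) (use pos in simp_all)
  then show ?thesis unfolding lhs rhs by simp
qed

theorem theorem4p7:
  fixes n :: nat and A B :: "complex mat" and t :: real
  assumes "pos_def n A" and "pos_def n B"
    and "-1 \<le> t" and "t \<le> -1/2"
  shows "log_maj n (spt n A t B)
           (mpow n (mpow n A (1 - t) * mpow n B (2*t) * mpow n A (1 - t)) (1/2))"
  unfolding log_maj_def
  using eigprod_spt_le[OF assms] det_spt[OF assms(1,2)] by (auto simp: eigprod_def)

end
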